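(* There is a symplectic embedding of the toric semidisk $(D^2_+\times T^2,\omega_0)$ into $(D^*K,\omega_{st})$, where $$D^2_+=\{(I_1,I_2)\in\mathbb{R}^2\mid I_1^2+I_2^2<1,\ I_1>0\},\qquad \omega_0=dx\wedge dI_1+dy\wedge dI_2 .$$
   Context: $T^2=\mathbb{R}^2/\mathbb{Z}^2$ with coordinates $(x,y)$. $K=\mathbb{R}^2/G$ is the flat Klein bottle, $G$ generated by $(x,y)\mapsto(x+1,y)$ and $(x,y)\mapsto(1-x,y+1/2)$. $D^*K$ is the unit disk cotangent bundle of $K$ with respect to the flat metric, with the standard symplectic form $\omega_{st}=dx\wedge dz+dy\wedge dw$, where $(x,y)$ are local coordinates on $K$ induced from $\mathbb{R}^2$ and $(z,w)$ the induced fiber coordinates. *)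

theory Defs
  imports "HOL-Analysis.Analysis" "HOL-Algebra.Bij" "HOL-Algebra.Generated_Groups"
begin

section \<open>Smooth manifolds, given by atlases\<close>

text \<open>The sets \<open>S\<close> below are always open, so that derivatives are taken at interior points.\<close>

fun Ck_on :: "nat \<Rightarrow> 'a::euclidean_space set \<Rightarrow> ('a \<Rightarrow> 'b::euclidean_space) \<Rightarrow> bool" where
  "Ck_on 0 S f \<longleftrightarrow> continuous_on S f"
| "Ck_on (Suc k) S f \<longleftrightarrow>
     (\<forall>x\<in>S. f differentiable (at x)) \<and>
     (\<forall>v. Ck_on k S (\<lambda>x. frechet_derivative f (at x) v))"

definition smooth_on :: "'a::euclidean_space set \<Rightarrow> ('a \<Rightarrow> 'b::euclidean_space) \<Rightarrow> bool" where
  "smooth_on S f \<longleftrightarrow> (\<forall>k. Ck_on k S f)"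

text \<open>A chart is a pair \<open>(U, \<phi>)\<close>; the values of \<open>\<phi>\<close> outside of \<open>U\<close> are irrelevant.
  A manifold is represented by an atlas; its underlying set is the union of the chart domains and
  it carries the topology induced by the charts.\<close>

type_synonym ('m, 'e) chart = "'m set \<times> ('m \<Rightarrow> 'e)"

type_synonym ('m, 'e) atlas = "('m, 'e) chart set"

definition atlas_carrier :: "('m, 'e) atlas \<Rightarrow> 'm set" where
  "atlas_carrier A = (\<Union>(U, \<phi>)\<in>A. U)"

definition atlas_topology :: "('m, 'e::euclidean_space) atlas \<Rightarrow> 'm topology" where
  "atlas_topology A = topology_generated_by {{p \<in> U. \<phi> p \<in> S} | U \<phi> S. (U, \<phi>) \<in> A \<and> open S}"

definition transition :: "('m, 'e) chart \<Rightarrow> ('n, 'f) chart \<Rightarrow> ('m \<Rightarrow> 'n) \<Rightarrow> 'e \<Rightarrow> 'f" where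
  "transition c d f = snd d \<circ> f \<circ> inv_into (fst c) (snd c)"

definition smooth_atlas :: "('m, 'e::euclidean_space) atlas \<Rightarrow> bool" where
  "smooth_atlas A \<longleftrightarrow>
     (\<forall>(U, \<phi>)\<in>A. inj_on \<phi> U \<and> open (\<phi> ` U)) \<and>
     (\<forall>(U, \<phi>)\<in>A. \<forall>(V, \<psi>)\<in>A.
        open (\<phi> ` (U \<inter> V)) \<and> smooth_on (\<phi> ` (U \<inter> V)) (transition (U, \<phi>) (V, \<psi>) id))"

definition smooth_map ::
  "('m, 'e::euclidean_space) atlas \<Rightarrow> ('n, 'f::euclidean_space) atlas \<Rightarrow> ('m \<Rightarrow> 'n) \<Rightarrow> bool" where
  "smooth_map A B f \<longleftrightarrow>
     continuous_map (atlas_topology A) (atlas_topology B) f \<and>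
     (\<forall>(U, \<phi>)\<in>A. \<forall>(V, \<psi>)\<in>B.
        smooth_on (\<phi> ` {p \<in> U. f p \<in> V}) (transition (U, \<phi>) (V, \<psi>) f))"

text \<open>The differential of \<open>f\<close> at \<open>p\<close> with respect to charts \<open>c\<close> around \<open>p\<close> and \<open>d\<close> around \<open>f p\<close>.\<close>

definition differential ::
  "('m, 'e::euclidean_space) chart \<Rightarrow> ('n, 'f::euclidean_space) chart \<Rightarrow> ('m \<Rightarrow> 'n) \<Rightarrow> 'm \<Rightarrow> 'e \<Rightarrow> 'f"
  where
  "differential c d f p = frechet_derivative (transition c d f) (at (snd c p))"

definition smooth_immersion ::
  "('m, 'e::euclidean_space) atlas \<Rightarrow> ('n, 'f::euclidean_space) atlas \<Rightarrow> ('m \<Rightarrow> 'n) \<Rightarrow> bool" where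
  "smooth_immersion A B f \<longleftrightarrow>
     smooth_map A B f \<and>
     (\<forall>c\<in>A. \<forall>d\<in>B. \<forall>p\<in>fst c. f p \<in> fst d \<longrightarrow> inj (differential c d f p))"

definition smooth_embedding ::
  "('m, 'e::euclidean_space) atlas \<Rightarrow> ('n, 'f::euclidean_space) atlas \<Rightarrow> ('m \<Rightarrow> 'n) \<Rightarrow> bool" where
  "smooth_embedding A B f \<longleftrightarrow>
     smooth_immersion A B f \<and> embedding_map (atlas_topology A) (atlas_topology B) f"

text \<open>Covariant 2-tensors (2-forms, Riemannian metrics) are given by their coordinate expressions:
  \<open>t c u v w\<close> is the value at the point with coordinates \<open>u\<close> in the chart \<open>c\<close>, on
  the tangent vectors with coordinates \<open>v\<close> and \<open>w\<close>.\<close>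

type_synonym ('m, 'e) tensor2 = "('m, 'e) chart \<Rightarrow> 'e \<Rightarrow> 'e \<Rightarrow> 'e \<Rightarrow> real"

definition pulls_back_to ::
  "('m, 'e::euclidean_space) atlas \<Rightarrow> ('m, 'e) tensor2 \<Rightarrow>
   ('n, 'f::euclidean_space) atlas \<Rightarrow> ('n, 'f) tensor2 \<Rightarrow> ('m \<Rightarrow> 'n) \<Rightarrow> bool" where
  "pulls_back_to A \<omega> B \<omega>' f \<longleftrightarrow>
     (\<forall>c\<in>A. \<forall>d\<in>B. \<forall>p\<in>fst c. f p \<in> fst d \<longrightarrow>
        (\<forall>v w. \<omega>' d (snd d (f p)) (differential c d f p v) (differential c d f p w)
               = \<omega> c (snd c p) v w))"

definition symplectic_embedding ::
  "('m, 'e::euclidean_space) atlas \<Rightarrow> ('m, 'e) tensor2 \<Rightarrow>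
   ('n, 'f::euclidean_space) atlas \<Rightarrow> ('n, 'f) tensor2 \<Rightarrow> ('m \<Rightarrow> 'n) \<Rightarrow> bool" where
  "symplectic_embedding A \<omega> B \<omega>' f \<longleftrightarrow>
     smooth_embedding A B f \<and> pulls_back_to A \<omega> B \<omega>' f"

definition wedge :: "('e \<Rightarrow> real) \<Rightarrow> ('e \<Rightarrow> real) \<Rightarrow> 'e \<Rightarrow> 'e \<Rightarrow> real" where
  "wedge \<alpha> \<beta> v w = \<alpha> v * \<beta> w - \<alpha> w * \<beta> v"

section \<open>Constructions of manifolds\<close>

definition open_submanifold :: "('m, 'e) atlas \<Rightarrow> 'm set \<Rightarrow> ('m, 'e) atlas" where
  "open_submanifold A W = {(U \<inter> W, \<phi>) | U \<phi>. (U, \<phi>) \<in> A}"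

definition euclidean_atlas :: "('e::euclidean_space, 'e) atlas" where
  "euclidean_atlas = {(UNIV, id)}"

definition prod_atlas :: "('m, 'e) atlas \<Rightarrow> ('n, 'f) atlas \<Rightarrow> ('m \<times> 'n, 'e \<times> 'f) atlas" where
  "prod_atlas A B = {(U \<times> V, map_prod \<phi> \<psi>) | U \<phi> V \<psi>. (U, \<phi>) \<in> A \<and> (V, \<psi>) \<in> B}"

text \<open>The quotient of Euclidean space by a group of transformations (acting freely and properly
  discontinuously): points are orbits, and the charts are the local inverses of the projection.\<close>

definition orbit_of :: "('e \<Rightarrow> 'e) set \<Rightarrow> 'e \<Rightarrow> 'e set" where
  "orbit_of G u = {g u | g. g \<in> G}"

definition quotient_atlas :: "('e::euclidean_space \<Rightarrow> 'e) set \<Rightarrow> ('e set, 'e) atlas" where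
  "quotient_atlas G =
     {(orbit_of G ` W, inv_into W (orbit_of G)) | W. open W \<and> inj_on (orbit_of G) W}"

text \<open>A covector at \<open>p\<close> is represented by the family of its components \<open>\<xi> c\<close> in all charts \<open>c\<close> around
  \<open>p\<close>, subject to the usual transformation law; \<open>\<xi> c \<bullet> v\<close> is its value on the tangent vector with
  coordinates \<open>v\<close> in the chart \<open>c\<close>.\<close>

type_synonym ('m, 'e) covector = "'m \<times> (('m, 'e) chart \<Rightarrow> 'e)"

definition cotangent_bundle :: "('m, 'e::euclidean_space) atlas \<Rightarrow> ('m, 'e) covector set" where
  "cotangent_bundle A =
     {(p, \<xi>). p \<in> atlas_carrier A \<and>
        \<xi> \<in> extensional {c \<in> A. p \<in> fst c} \<and>
        (\<forall>c\<in>A. \<forall>d\<in>A. p \<in> fst c \<inter> fst d \<longrightarrow>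
           (\<forall>v. \<xi> c \<bullet> v = \<xi> d \<bullet> differential c d id p v))}"

definition cotangent_chart ::
  "('m, 'e::euclidean_space) atlas \<Rightarrow> ('m, 'e) chart \<Rightarrow> (('m, 'e) covector, 'e \<times> 'e) chart" where
  "cotangent_chart A c =
     ({(p, \<xi>). (p, \<xi>) \<in> cotangent_bundle A \<and> p \<in> fst c}, \<lambda>(p, \<xi>). (snd c p, \<xi> c))"

definition cotangent_atlas ::
  "('m, 'e::euclidean_space) atlas \<Rightarrow> (('m, 'e) covector, 'e \<times> 'e) atlas" where
  "cotangent_atlas A = cotangent_chart A ` A"

text \<open>The norm on covectors dual to an inner product \<open>g\<close> on tangent vectors.\<close>

definition dual_norm :: "('e \<Rightarrow> 'e \<Rightarrow> real) \<Rightarrow> 'e::euclidean_space \<Rightarrow> real" where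
  "dual_norm g \<eta> = (SUP v\<in>{v. g v v \<le> 1}. \<bar>\<eta> \<bullet> v\<bar>)"

definition unit_disk_cotangent_bundle ::
  "('m, 'e::euclidean_space) atlas \<Rightarrow> ('m, 'e) tensor2 \<Rightarrow> (('m, 'e) covector, 'e \<times> 'e) atlas" where
  "unit_disk_cotangent_bundle A g =
     open_submanifold (cotangent_atlas A)
       {(p, \<xi>). \<forall>c\<in>A. p \<in> fst c \<longrightarrow> dual_norm (g c (snd c p)) (\<xi> c) < 1}"

section \<open>The torus, the Klein bottle and their symplectic forms\<close>

definition torus_group :: "(real \<times> real \<Rightarrow> real \<times> real) set" where
  "torus_group = {\<lambda>(x, y). (x + of_int m, y + of_int n) | m n. True}"

definition torus :: "((real \<times> real) set, real \<times> real) atlas" where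
  "torus = quotient_atlas torus_group"

definition klein_group :: "(real \<times> real \<Rightarrow> real \<times> real) set" where
  "klein_group = generate (BijGroup UNIV) {\<lambda>(x, y). (x + 1, y), \<lambda>(x, y). (1 - x, y + 1 / 2)}"

definition klein_bottle :: "((real \<times> real) set, real \<times> real) atlas" where
  "klein_bottle = quotient_atlas klein_group"

text \<open>The elements of \<open>klein_group\<close> are isometries, so in the charts of \<open>klein_bottle\<close> the metric
  induced from the plane is the Euclidean one.\<close>

definition flat_metric :: "('m, 'e::euclidean_space) tensor2" where
  "flat_metric c u v w = v \<bullet> w"

definition DK :: "(((real \<times> real) set, real \<times> real) covector, (real \<times> real) \<times> (real \<times> real)) atlas"
  where "DK = unit_disk_cotangent_bundle klein_bottle flat_metric"

text \<open>In the charts of \<open>DK\<close> the coordinates are \<open>((x, y), (z, w))\<close>, where \<open>(z, w)\<close> are the fiber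
  coordinates induced by \<open>(x, y)\<close>.\<close>

definition omega_st :: "('m, (real \<times> real) \<times> (real \<times> real)) tensor2" where
  "omega_st c u v v' =
     wedge (\<lambda>((x, y), (z, w)). x) (\<lambda>((x, y), (z, w)). z) v v' +
     wedge (\<lambda>((x, y), (z, w)). y) (\<lambda>((x, y), (z, w)). w) v v'"

definition semidisk :: "(real \<times> real) set" where
  "semidisk = {(I\<^sub>1, I\<^sub>2). I\<^sub>1\<^sup>2 + I\<^sub>2\<^sup>2 < 1 \<and> I\<^sub>1 > 0}"

definition toric_semidisk ::
  "((real \<times> real) \<times> (real \<times> real) set, (real \<times> real) \<times> (real \<times> real)) atlas" where
  "toric_semidisk = prod_atlas (open_submanifold euclidean_atlas semidisk) torus"

text \<open>In the charts of \<open>toric_semidisk\<close> the coordinates are \<open>((I\<^sub>1, I\<^sub>2), (x, y))\<close>.\<close>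

definition omega_0 :: "('m, (real \<times> real) \<times> (real \<times> real)) tensor2" where
  "omega_0 c u v v' =
     wedge (\<lambda>((I\<^sub>1, I\<^sub>2), (x, y)). x) (\<lambda>((I\<^sub>1, I\<^sub>2), (x, y)). I\<^sub>1) v v' +
     wedge (\<lambda>((I\<^sub>1, I\<^sub>2), (x, y)). y) (\<lambda>((I\<^sub>1, I\<^sub>2), (x, y)). I\<^sub>2) v v'"

section \<open>The structures are well defined\<close>

text \<open>The atlases above are smooth, the topologies of the torus and of the Klein bottle are the quotient
  topologies, and the coordinate expressions of the metric and of the symplectic forms are compatible
  with changes of charts, i.e. they pull back to themselves under the identity.\<close>

definition isometry_group :: "('e::euclidean_space \<Rightarrow> 'e) set \<Rightarrow> bool" where
  "isometry_group G \<longleftrightarrow>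
     id \<in> G \<and> (\<forall>g\<in>G. \<forall>h\<in>G. g \<circ> h \<in> G) \<and> (\<forall>g\<in>G. \<exists>h\<in>G. h \<circ> g = id \<and> g \<circ> h = id) \<and>
     (\<forall>g\<in>G. \<exists>L b. orthogonal_transformation L \<and> g = (\<lambda>u. L u + b)) \<and>
     (\<forall>u. \<exists>W. open W \<and> u \<in> W \<and> inj_on (orbit_of G) W)"

lemma Ck_on_locally_affine:
  assumes "\<And>x. x \<in> S \<Longrightarrow> \<exists>N L b. open N \<and> x \<in> N \<and> bounded_linear L \<and> (\<forall>y\<in>N. f y = L y + b)"
  shows "Ck_on k S f"
  using assms
proof (induction k arbitrary: f)
  case 0
  have "isCont f x" if "x \<in> S" for x
  proof -
    obtain N L b where N: "open N" "x \<in> N" "bounded_linear L" "\<forall>y\<in>N. f y = L y + b"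
      using 0[OF \<open>x \<in> S\<close>] by blast
    have "isCont (\<lambda>y. L y + b) x"
      using N(3) by (intro continuous_intros linear_continuous_at)
    moreover have "eventually (\<lambda>y. f y = L y + b) (nhds x)"
      using N by (auto simp: eventually_nhds)
    ultimately show ?thesis by (simp add: isCont_cong)
  qed
  then show ?case by (simp add: continuous_at_imp_continuous_on)
next
  case (Suc k)
  have der: "(f has_derivative L) (at x)"
    if "open N" "x \<in> N" "bounded_linear L" "\<forall>y\<in>N. f y = L y + b" for x N L b
  proof -
    have "((\<lambda>y. L y + b) has_derivative L) (at x)"
      using that(3) by (auto intro!: derivative_eq_intros bounded_linear_imp_has_derivative)
    then show ?thesis
      by (rule has_derivative_transform_within_open[OF _ that(1,2)]) (use that in auto)
  qed
  have "f differentiable (at x)" if "x \<in> S" for x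
    using Suc.prems[OF that] der unfolding differentiable_def by metis
  moreover have "Ck_on k S (\<lambda>x. frechet_derivative f (at x) v)" for v
  proof (rule Suc.IH)
    fix x assume "x \<in> S"
    then obtain N L b where N: "open N" "x \<in> N" "bounded_linear L" "\<forall>y\<in>N. f y = L y + b"
      using Suc.prems by metis
    have "frechet_derivative f (at y) v = 0 + L v" if "y \<in> N" for y
      using frechet_derivative_at[OF der[OF N(1) that N(3,4)]] by simp
    then show "\<exists>N L b. open N \<and> x \<in> N \<and> bounded_linear L \<and>
        (\<forall>y\<in>N. frechet_derivative f (at y) v = L y + b)"
      using N(1,2) bounded_linear_zero by (intro exI[of _ N] exI[of _ "\<lambda>_. 0"] exI[of _ "L v"]) auto
  qed
  ultimately show ?case by simp
qed

lemma differential_locally_affine: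
  assumes "open N" "snd c p \<in> N" "bounded_linear L" "\<And>y. y \<in> N \<Longrightarrow> transition c d f y = L y + b"
  shows "differential c d f p = L"
proof -
  have "((\<lambda>y. L y + b) has_derivative L) (at (snd c p))"
    using assms(3) by (auto intro!: derivative_eq_intros bounded_linear_imp_has_derivative)
  then have "(transition c d f has_derivative L) (at (snd c p))"
    by (rule has_derivative_transform_within_open[OF _ assms(1,2)]) (use assms(4) in auto)
  then show ?thesis
    unfolding differential_def using frechet_derivative_at by metis
qed

context
  fixes G :: "('e::euclidean_space \<Rightarrow> 'e) set"
  assumes G: "isometry_group G"
begin

private lemma orbit_eq_iff: "orbit_of G u = orbit_of G v \<longleftrightarrow> (\<exists>g\<in>G. v = g u)"
proof
  assume *: "orbit_of G u = orbit_of G v"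
  have "v \<in> orbit_of G v"
    using G unfolding isometry_group_def orbit_of_def by (metis (mono_tags, lifting) id_apply mem_Collect_eq)
  with * show "\<exists>g\<in>G. v = g u" unfolding orbit_of_def by auto
next
  have sub: "orbit_of G (g w) \<subseteq> orbit_of G w" if "g \<in> G" for g w
  proof
    fix z assume "z \<in> orbit_of G (g w)"
    then obtain h where h: "h \<in> G" "z = h (g w)" unfolding orbit_of_def by auto
    then have "h \<circ> g \<in> G" using G \<open>g \<in> G\<close> unfolding isometry_group_def by simp
    then have "(h \<circ> g) w \<in> orbit_of G w" unfolding orbit_of_def by blast
    then show "z \<in> orbit_of G w" using h(2) by simp
  qed
  assume "\<exists>g\<in>G. v = g u"
  then obtain g where g: "g \<in> G" "v = g u" by auto
  then obtain h where "h \<in> G" "h \<circ> g = id" using G unfolding isometry_group_def by metis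
  then have "h v = u" using g by (metis comp_apply id_apply)
  then show "orbit_of G u = orbit_of G v"
    using sub[of g u] sub[of h v] g \<open>h \<in> G\<close> by auto
qed

private lemma continuous_elem: "g \<in> G \<Longrightarrow> continuous_on UNIV g"
proof -
  assume "g \<in> G"
  then obtain L b where "orthogonal_transformation L" "g = (\<lambda>u. L u + b)"
    using G unfolding isometry_group_def by metis
  moreover from this have "continuous_on UNIV L"
    by (simp add: linear_continuous_on linear_conv_bounded_linear[symmetric] orthogonal_transformation_linear)
  ultimately show ?thesis by (auto intro!: continuous_intros)
qed

private lemma open_preimage_elem: "g \<in> G \<Longrightarrow> open S \<Longrightarrow> open (g -` S)"
  using continuous_elem open_vimage by blast

private lemma chart_cases:
  assumes "c \<in> quotient_atlas G"
  obtains W where "open W" "inj_on (orbit_of G) W" "fst c = orbit_of G ` W"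
    "snd c = inv_into W (orbit_of G)"
    "snd c ` fst c = W"  "inj_on (snd c) (fst c)" 
    "\<And>u. u \<in> W \<Longrightarrow> snd c (orbit_of G u) = u" "\<And>u. u \<in> W \<Longrightarrow> inv_into (fst c) (snd c) u = orbit_of G u"
proof -
  obtain W where W: "open W" "inj_on (orbit_of G) W" "fst c = orbit_of G ` W"
    "snd c = inv_into W (orbit_of G)"
    using assms unfolding quotient_atlas_def by auto
  have 1: "snd c (orbit_of G u) = u" if "u \<in> W" for u
    using that W by simp
  have 2: "inj_on (snd c) (fst c)"
    unfolding W(3) using 1 by (auto simp: inj_on_def)
  have 3: "inv_into (fst c) (snd c) u = orbit_of G u" if "u \<in> W" for u
    using inv_into_f_f[OF 2, of "orbit_of G u"] 1[OF that] that W(3) by auto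
  have "snd c ` fst c = W" unfolding W(3) using 1 by force
  then show ?thesis using that[OF W _ 2 1 3] by simp
qed

lemma quotient_transition:
  assumes "c \<in> quotient_atlas G" "d \<in> quotient_atlas G" "p \<in> fst c" "p \<in> fst d"
  obtains N L b where "open N" "snd c p \<in> N" "N \<subseteq> snd c ` (fst c \<inter> fst d)"
    "orthogonal_transformation L" "\<And>y. y \<in> N \<Longrightarrow> transition c d id y = L y + b"
    "(\<lambda>u. L u + b) \<in> G"
proof -
  obtain W where W: "open W" "fst c = orbit_of G ` W" "\<And>u. u \<in> W \<Longrightarrow> snd c (orbit_of G u) = u"
     "\<And>u. u \<in> W \<Longrightarrow> inv_into (fst c) (snd c) u = orbit_of G u" using assms(1) chart_cases by metis
  obtain W' where W': "open W'" "fst d = orbit_of G ` W'" "\<And>u. u \<in> W' \<Longrightarrow> snd d (orbit_of G u) = u"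
     using assms(2) chart_cases by metis
  obtain u where u: "u \<in> W" "p = orbit_of G u" using W assms by auto
  obtain u' where u': "u' \<in> W'" "p = orbit_of G u'" using W' assms by auto
  obtain g where g: "g \<in> G" "u' = g u" using orbit_eq_iff u u' by metis
  have o: "orbit_of G (g y) = orbit_of G y" for y using orbit_eq_iff g(1) by metis
  obtain L b where L: "orthogonal_transformation L" "g = (\<lambda>u. L u + b)"
    using G g unfolding isometry_group_def by metis
  show ?thesis
  proof (rule that[of "W \<inter> g -` W'" L b])
    show "open (W \<inter> g -` W')" by (intro open_Int W(1) open_preimage_elem g(1) W'(1))
    show "snd c p \<in> W \<inter> g -` W'" using u u' g W by auto
    show "W \<inter> g -` W' \<subseteq> snd c ` (fst c \<inter> fst d)"
    proof
      fix y assume y: "y \<in> W \<inter> g -` W'"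
      then have "orbit_of G y \<in> fst c" "orbit_of G (g y) \<in> fst d" unfolding W(2) W'(2) by auto
      then show "y \<in> snd c ` (fst c \<inter> fst d)"
        using W(3)[of y] y o[of y] by (intro image_eqI[of _ _ "orbit_of G y"]) auto
    qed
    show "transition c d id y = L y + b" if "y \<in> W \<inter> g -` W'" for y
      using that W(4)[of y] W'(3)[of "g y"] o[of y] L(2) unfolding transition_def by simp
  qed (use L g in auto)
qed

lemma smooth_atlas_quotient: "smooth_atlas (quotient_atlas G)"
  unfolding smooth_atlas_def
proof (intro conjI ballI; clarify)
  fix U \<phi> assume "(U, \<phi>) \<in> quotient_atlas G"
  then show "inj_on \<phi> U \<and> open (\<phi> ` U)" using chart_cases by (metis fst_conv snd_conv)
next
  fix U \<phi> V \<psi> assume c: "(U, \<phi>) \<in> quotient_atlas G" "(V, \<psi>) \<in> quotient_atlas G"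
  have *: "\<exists>N L b. open N \<and> x \<in> N \<and> N \<subseteq> \<phi> ` (U \<inter> V) \<and> bounded_linear L \<and>
     (\<forall>y\<in>N. transition (U, \<phi>) (V, \<psi>) id y = L y + b)" if x: "x \<in> \<phi> ` (U \<inter> V)" for x
  proof -
    obtain p where p: "p \<in> U" "p \<in> V" "x = \<phi> p" using x by auto
    show ?thesis
      using quotient_transition[OF c, of p] p
      by (metis fst_conv snd_conv linear_conv_bounded_linear orthogonal_transformation_linear)
  qed
  have "open (\<phi> ` (U \<inter> V))"
    unfolding open_subopen[of "\<phi> ` (U \<inter> V)"] using * by metis
  moreover have "smooth_on (\<phi> ` (U \<inter> V)) (transition (U, \<phi>) (V, \<psi>) id)"
    unfolding smooth_on_def by (intro allI Ck_on_locally_affine) (use * in metis)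
  ultimately show "open (\<phi> ` (U \<inter> V)) \<and> smooth_on (\<phi> ` (U \<inter> V)) (transition (U, \<phi>) (V, \<psi>) id)"
    by simp
qed

lemma flat_metric_quotient: "pulls_back_to (quotient_atlas G) flat_metric (quotient_atlas G) flat_metric id"
  unfolding pulls_back_to_def
proof (intro ballI impI allI)
  fix c d p v w
  assume "c \<in> quotient_atlas G" "d \<in> quotient_atlas G" "p \<in> fst c" "id p \<in> fst d"
  then obtain N L b where N: "open N" "snd c p \<in> N" "orthogonal_transformation L"
    "\<And>y. y \<in> N \<Longrightarrow> transition c d id y = L y + b"
    using quotient_transition by (metis id_apply)
  then have "differential c d id p = L"
    by (intro differential_locally_affine[of N])
       (auto simp: orthogonal_transformation_linear linear_conv_bounded_linear[symmetric])
  then show "flat_metric d (snd d (id p)) (differential c d id p v) (differential c d id p w) =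
             flat_metric c (snd c p) v w"
    using N(3) by (simp add: flat_metric_def orthogonal_transformation_def)
qed

lemma quotient_map_quotient: "quotient_map euclidean (atlas_topology (quotient_atlas G)) (orbit_of G)"
proof -
  let ?T = "atlas_topology (quotient_atlas G)"
  let ?B = "{{p \<in> U. \<phi> p \<in> S} | U \<phi> S. (U, \<phi>) \<in> quotient_atlas G \<and> open S}"
  have T: "topspace ?T = \<Union>?B"
    unfolding atlas_topology_def by (rule topology_generated_by_topspace)
  have img: "openin ?T (orbit_of G ` W)" if "open W" "inj_on (orbit_of G) W" for W
  proof -
    have "(orbit_of G ` W, inv_into W (orbit_of G)) \<in> quotient_atlas G"
      using that unfolding quotient_atlas_def by auto
    then have "{p \<in> orbit_of G ` W. inv_into W (orbit_of G) p \<in> UNIV} \<in> ?B"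
      using open_UNIV by blast
    then have "openin ?T {p \<in> orbit_of G ` W. inv_into W (orbit_of G) p \<in> UNIV}"
      unfolding atlas_topology_def by (rule topology_generated_by_Basis)
    then show ?thesis by simp
  qed
  have pre: "open (orbit_of G -` B)" if B: "B \<in> ?B" for B
  proof -
    obtain c S where c: "c \<in> quotient_atlas G" "open S" "B = {p \<in> fst c. snd c p \<in> S}"
      using B by force
    obtain W where W: "open W" "fst c = orbit_of G ` W" "\<And>u. u \<in> W \<Longrightarrow> snd c (orbit_of G u) = u"
      using c(1) chart_cases by metis
    have "orbit_of G -` B = (\<Union>g\<in>G. g -` (W \<inter> S))"
    proof (intro Set.set_eqI iffI)
      fix u assume "u \<in> orbit_of G -` B"
      then obtain w where w: "w \<in> W" "orbit_of G u = orbit_of G w" "snd c (orbit_of G u) \<in> S"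
        using c W by auto
      then obtain g where "g \<in> G" "w = g u" using orbit_eq_iff by metis
      moreover have "w \<in> S" using w W(3) by simp
      ultimately show "u \<in> (\<Union>g\<in>G. g -` (W \<inter> S))" using w by auto
    next
      fix u assume "u \<in> (\<Union>g\<in>G. g -` (W \<inter> S))"
      then obtain g where g: "g \<in> G" "g u \<in> W" "g u \<in> S" by auto
      then have "orbit_of G u = orbit_of G (g u)" using orbit_eq_iff by metis
      then show "u \<in> orbit_of G -` B" using g c W by auto
    qed
    then show ?thesis using W c open_preimage_elem by (simp add: open_Int open_UN)
  qed
  have cont: "continuous_map euclidean ?T (orbit_of G)"
    unfolding atlas_topology_def
  proof (rule continuous_on_generated_topo)
    show "openin euclidean (orbit_of G -` U \<inter> topspace euclidean)" if "U \<in> ?B" for U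
      using pre[OF that] by simp
    show "orbit_of G ` topspace euclidean \<subseteq> \<Union>?B"
    proof
      fix p assume "p \<in> orbit_of G ` topspace euclidean"
      then obtain u W where "p = orbit_of G u" "open W" "u \<in> W" "inj_on (orbit_of G) W"
        using G unfolding isometry_group_def by blast
      then have "p \<in> topspace ?T" using openin_subset[OF img[of W]] by auto
      then show "p \<in> \<Union>?B" unfolding T .
    qed
  qed
  have opn: "open_map euclidean ?T (orbit_of G)"
    unfolding open_map_def
  proof (intro allI impI)
    fix S :: "'e set" assume S: "openin euclidean S"
    have "\<exists>W. open W \<and> u \<in> W \<and> W \<subseteq> S \<and> inj_on (orbit_of G) W" if "u \<in> S" for u
    proof -
      obtain W where "open W" "u \<in> W" "inj_on (orbit_of G) W"
        using G unfolding isometry_group_def by blast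
      then show ?thesis
        using S that by (intro exI[of _ "W \<inter> S"]) (auto intro: inj_on_subset)
    qed
    then have "\<exists>V. openin ?T V \<and> orbit_of G u \<in> V \<and> V \<subseteq> orbit_of G ` S" if "u \<in> S" for u
      using that img by (meson imageI image_mono)
    then show "openin ?T (orbit_of G ` S)" using openin_subopen[of ?T "orbit_of G ` S"] by auto
  qed
  have "topspace ?T \<subseteq> range (orbit_of G)"
    unfolding T by (auto simp: quotient_atlas_def)
  moreover have "range (orbit_of G) \<subseteq> topspace ?T"
    using continuous_map_image_subset_topspace[OF cont] by simp
  ultimately show ?thesis
    using continuous_open_imp_quotient_map[OF cont opn] by simp
qed

lemma inj_quotient_chart: "c \<in> quotient_atlas G \<Longrightarrow> inj_on (snd c) (fst c)"
  using chart_cases by metis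

lemma quotient_differential:
  assumes "c \<in> quotient_atlas G" "d \<in> quotient_atlas G" "p \<in> fst c" "p \<in> fst d"
  obtains N b where "open N" "snd c p \<in> N" "N \<subseteq> snd c ` (fst c \<inter> fst d)"
    "orthogonal_transformation (differential c d id p)"
    "\<And>y. y \<in> N \<Longrightarrow> transition c d id y = differential c d id p y + b"
    "(\<lambda>u. differential c d id p u + b) \<in> G"
proof -
  obtain N L b where N: "open N" "snd c p \<in> N" "N \<subseteq> snd c ` (fst c \<inter> fst d)"
    "orthogonal_transformation L" "\<And>y. y \<in> N \<Longrightarrow> transition c d id y = L y + b"
    "(\<lambda>u. L u + b) \<in> G"
    using quotient_transition[OF assms] by blast
  have "differential c d id p = L"
    using N by (intro differential_locally_affine[of N])
       (auto simp: orthogonal_transformation_linear linear_conv_bounded_linear[symmetric])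
  with N show ?thesis by (intro that[of N b]) simp_all
qed

lemma transition_id:
  assumes "c \<in> quotient_atlas G" "p \<in> fst c"
  shows "transition c d id (snd c p) = snd d p"
  using inv_into_f_f[OF inj_quotient_chart[OF assms(1)] assms(2)] by (simp add: transition_def)

lemma differential_id:
  assumes "c \<in> quotient_atlas G" "p \<in> fst c"
  shows "differential c c id p = id"
proof -
  obtain N where N: "open N" "snd c p \<in> N" "N \<subseteq> snd c ` (fst c \<inter> fst c)"
    using quotient_differential[OF assms(1) assms(1) assms(2) assms(2)] by metis
  have "transition c c id y = id y + 0" if "y \<in> N" for y
    using that N(3) transition_id[OF assms(1), of _ c] by auto
  then show ?thesis
    using N by (intro differential_locally_affine[of N]) (auto simp: id_def bounded_linear_ident)
qed

lemma differential_comp: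
  assumes c: "c \<in> quotient_atlas G" "p \<in> fst c" and d: "d \<in> quotient_atlas G" "p \<in> fst d"
    and e: "e \<in> quotient_atlas G" "p \<in> fst e"
  shows "differential c e id p = differential d e id p \<circ> differential c d id p"
proof -
  let ?L1 = "differential c d id p" and ?L2 = "differential d e id p"
  obtain N1 b1 where N1: "open N1" "snd c p \<in> N1" "N1 \<subseteq> snd c ` (fst c \<inter> fst d)"
    "orthogonal_transformation ?L1" "\<And>y. y \<in> N1 \<Longrightarrow> transition c d id y = ?L1 y + b1"
    using quotient_differential[OF c(1) d(1) c(2) d(2)] by metis
  obtain N2 b2 where N2: "open N2" "snd d p \<in> N2"
    "orthogonal_transformation ?L2" "\<And>y. y \<in> N2 \<Longrightarrow> transition d e id y = ?L2 y + b2"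
    using quotient_differential[OF d(1) e(1) d(2) e(2)] by metis
  have lin: "linear ?L1" "linear ?L2" using N1 N2 orthogonal_transformation_linear by auto
  let ?N = "N1 \<inter> (\<lambda>y. ?L1 y + b1) -` N2"
  have "continuous_on UNIV (\<lambda>y. ?L1 y + b1)"
    using lin by (intro continuous_intros linear_continuous_on) (simp add: linear_conv_bounded_linear[symmetric])
  then have "open ?N" using N1(1) N2(1) open_vimage by blast
  moreover have "snd c p \<in> ?N"
    using N1(2) N1(5)[OF N1(2)] transition_id[OF c, of d] N2(2) by auto
  moreover have "transition c e id y = (?L2 \<circ> ?L1) y + (?L2 b1 + b2)" if y: "y \<in> ?N" for y
  proof -
    obtain q where q: "y = snd c q" "q \<in> fst c" "q \<in> fst d" using y N1(3) by auto
    have "transition c d id y = snd d q" using q transition_id[OF c(1)] by simp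
    then have 1: "snd d q = ?L1 y + b1" using N1(5) y by auto
    have "transition c e id y = snd e q" using q transition_id[OF c(1)] by simp
    also have "\<dots> = transition d e id (snd d q)" using transition_id[OF d(1) q(3), of e] by simp
    also have "\<dots> = ?L2 (?L1 y + b1) + b2" using N2(4)[of "?L1 y + b1"] y 1 by auto
    finally show ?thesis using lin by (simp add: linear_add)
  qed
  moreover have "bounded_linear (?L2 \<circ> ?L1)"
    using lin by (metis linear_compose linear_conv_bounded_linear)
  ultimately show ?thesis by (intro differential_locally_affine[of ?N]) auto
qed

lemma covector_component:
  assumes "(p, \<xi>) \<in> cotangent_bundle (quotient_atlas G)"
    "c \<in> quotient_atlas G" "p \<in> fst c" "d \<in> quotient_atlas G" "p \<in> fst d"
  shows "\<xi> d = differential c d id p (\<xi> c)"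
proof -
  let ?L = "differential c d id p"
  have L: "orthogonal_transformation ?L" using quotient_differential[OF assms(2,4,3,5)] by metis
  have "\<xi> d \<bullet> ?L v = ?L (\<xi> c) \<bullet> ?L v" for v
  proof -
    have "\<forall>c\<in>quotient_atlas G. \<forall>d\<in>quotient_atlas G. p \<in> fst c \<inter> fst d \<longrightarrow>
        (\<forall>v. \<xi> c \<bullet> v = \<xi> d \<bullet> differential c d id p v)"
      using assms(1) unfolding cotangent_bundle_def by fast
    from this[rule_format, OF assms(2,4)] have "\<xi> c \<bullet> v = \<xi> d \<bullet> ?L v"
      using assms(3,5) by blast
    then show ?thesis using L unfolding orthogonal_transformation_def by simp
  qed
  then have "\<xi> d \<bullet> w = ?L (\<xi> c) \<bullet> w" for w
    using orthogonal_transformation_surj[OF L] by (metis surjD)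
  then show ?thesis using vector_eq_ldot by (metis inner_commute)
qed

lemma covector_exists:
  assumes "c \<in> quotient_atlas G" "p \<in> fst c"
  obtains \<xi> where "(p, \<xi>) \<in> cotangent_bundle (quotient_atlas G)" "\<xi> c = a"
proof -
  let ?\<xi> = "restrict (\<lambda>d. differential c d id p a) {d \<in> quotient_atlas G. p \<in> fst d}"
  have law: "?\<xi> d \<bullet> v = ?\<xi> e \<bullet> differential d e id p v"
    if "d \<in> quotient_atlas G" "e \<in> quotient_atlas G" "p \<in> fst d" "p \<in> fst e" for d e v
  proof -
    have "orthogonal_transformation (differential d e id p)"
      using quotient_differential[OF that] by metis
    then show ?thesis
      using that differential_comp[OF assms that(1,3,2,4)]
      by (simp add: orthogonal_transformation_def)
  qed
  have "p \<in> atlas_carrier (quotient_atlas G)"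
    using assms unfolding atlas_carrier_def by (auto simp: case_prod_beta)
  then have "(p, ?\<xi>) \<in> cotangent_bundle (quotient_atlas G)"
    unfolding cotangent_bundle_def
    by (intro CollectI case_prodI conjI ballI impI allI restrict_extensional law) blast+
  moreover have "?\<xi> c = a" using assms differential_id[OF assms] by simp
  ultimately show ?thesis by (rule that)
qed

lemma dual_norm_flat: "dual_norm (flat_metric c u) \<eta> = norm \<eta>"
proof -
  have le: "\<bar>\<eta> \<bullet> v\<bar> \<le> norm \<eta>" if "v \<bullet> v \<le> 1" for v
  proof -
    have "norm v \<le> 1" using that by (simp add: norm_eq_sqrt_inner)
    then have "norm \<eta> * norm v \<le> norm \<eta> * 1" by (intro mult_left_mono) auto
    then show ?thesis using Cauchy_Schwarz_ineq2[of \<eta> v] by linarith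
  qed
  have nz: "\<eta> \<bullet> sgn \<eta> = norm \<eta>"
    by (cases "\<eta> = 0") (auto simp: sgn_div_norm dot_square_norm power2_eq_square)
  have "sgn \<eta> \<bullet> sgn \<eta> \<le> 1"
    by (cases "\<eta> = 0") (auto simp: dot_square_norm norm_sgn)
  then have "norm \<eta> \<le> (SUP v\<in>{v. v \<bullet> v \<le> 1}. \<bar>\<eta> \<bullet> v\<bar>)"
    by (intro cSUP_upper2[of _ _ "sgn \<eta>"] bdd_aboveI2[of _ _ "norm \<eta>"]) (auto simp: le nz)
  moreover have "(SUP v\<in>{v. v \<bullet> v \<le> 1}. \<bar>\<eta> \<bullet> v\<bar>) \<le> norm \<eta>"
    by (rule cSUP_least) (auto simp: le intro!: exI[of _ 0])
  ultimately show ?thesis unfolding dual_norm_def flat_metric_def by simp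
qed

private abbreviation (input) "DG \<equiv> unit_disk_cotangent_bundle (quotient_atlas G) flat_metric"

lemma disk_chart_cases:
  assumes "c' \<in> DG"
  obtains c where "c \<in> quotient_atlas G" "snd c' = (\<lambda>(p, \<xi>). (snd c p, \<xi> c))"
    "\<And>p \<xi>. (p, \<xi>) \<in> fst c' \<longleftrightarrow> (p, \<xi>) \<in> cotangent_bundle (quotient_atlas G) \<and> p \<in> fst c \<and> norm (\<xi> c) < 1"
proof -
  obtain c where c: "c \<in> quotient_atlas G" "snd c' = (\<lambda>(p, \<xi>). (snd c p, \<xi> c))"
    "fst c' = {(p, \<xi>). (p, \<xi>) \<in> cotangent_bundle (quotient_atlas G) \<and> p \<in> fst c} \<inter>
      {(p, \<xi>). \<forall>c\<in>quotient_atlas G. p \<in> fst c \<longrightarrow> norm (\<xi> c) < 1}"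
    using assms
    unfolding unit_disk_cotangent_bundle_def open_submanifold_def cotangent_atlas_def cotangent_chart_def
      dual_norm_flat
    by auto
  have "norm (\<xi> d) = norm (\<xi> c)"
    if "(p, \<xi>) \<in> cotangent_bundle (quotient_atlas G)" "p \<in> fst c" "d \<in> quotient_atlas G" "p \<in> fst d" for p \<xi> d
    using covector_component[OF that(1) c(1) that(2-4)] quotient_differential[OF c(1) that(3,2,4)]
      orthogonal_transformation_norm by metis
  then have "(p, \<xi>) \<in> fst c' \<longleftrightarrow>
      (p, \<xi>) \<in> cotangent_bundle (quotient_atlas G) \<and> p \<in> fst c \<and> norm (\<xi> c) < 1" for p \<xi>
    using c(1) unfolding c(3) by (auto simp del: split_paired_All split_paired_Ex)
  then show ?thesis using that[OF c(1,2)] by blast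
qed

lemma inj_disk_chart:
  assumes "c' \<in> DG"
  shows "inj_on (snd c') (fst c')"
proof -
  obtain c where c: "c \<in> quotient_atlas G" "snd c' = (\<lambda>(p, \<xi>). (snd c p, \<xi> c))"
    "\<And>p \<xi>. (p, \<xi>) \<in> fst c' \<longleftrightarrow> (p, \<xi>) \<in> cotangent_bundle (quotient_atlas G) \<and> p \<in> fst c \<and> norm (\<xi> c) < 1"
    using disk_chart_cases[OF assms] by metis
  show ?thesis
  proof (rule inj_onI)
    fix x y assume xy: "x \<in> fst c'" "y \<in> fst c'" "snd c' x = snd c' y"
    obtain p \<xi> q \<eta> where x: "x = (p, \<xi>)" and y: "y = (q, \<eta>)" by (metis surj_pair)
    have pq: "p \<in> fst c" "q \<in> fst c" using c(3) xy x y by auto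
    have "snd c p = snd c q" and e: "\<xi> c = \<eta> c" using xy(3) c(2) x y by auto
    then have "p = q" using inj_onD[OF inj_quotient_chart[OF c(1)]] pq by metis
    have xb: "(p, \<xi>) \<in> cotangent_bundle (quotient_atlas G)" "(p, \<eta>) \<in> cotangent_bundle (quotient_atlas G)"
      using c(3) xy x y \<open>p = q\<close> by auto
    have "\<xi> d = \<eta> d" if "d \<in> {c \<in> quotient_atlas G. p \<in> fst c}" for d
      using covector_component[OF xb(1) c(1) pq(1), of d] covector_component[OF xb(2) c(1) pq(1), of d]
        that e by auto
    then have "\<xi> = \<eta>"
      using xb extensionalityI unfolding cotangent_bundle_def by (metis (no_types, lifting) case_prodD mem_Collect_eq)
    then show "x = y" using x y \<open>p = q\<close> by simp
  qed
qed

lemma disk_transition: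
  assumes "c' \<in> DG" "d' \<in> DG" "x \<in> fst c'" "x \<in> fst d'"
  obtains N L b where "open N" "snd c' x \<in> N" "N \<subseteq> snd c' ` (fst c' \<inter> fst d')"
    "orthogonal_transformation L" "bounded_linear (map_prod L L)"
    "\<And>y. y \<in> N \<Longrightarrow> transition c' d' id y = map_prod L L y + (b, 0)"
proof -
  obtain c where c: "c \<in> quotient_atlas G" "snd c' = (\<lambda>(p, \<xi>). (snd c p, \<xi> c))"
    "\<And>p \<xi>. (p, \<xi>) \<in> fst c' \<longleftrightarrow> (p, \<xi>) \<in> cotangent_bundle (quotient_atlas G) \<and> p \<in> fst c \<and> norm (\<xi> c) < 1"
    using disk_chart_cases[OF assms(1)] by metis
  obtain d where d: "d \<in> quotient_atlas G" "snd d' = (\<lambda>(p, \<xi>). (snd d p, \<xi> d))"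
    "\<And>p \<xi>. (p, \<xi>) \<in> fst d' \<longleftrightarrow> (p, \<xi>) \<in> cotangent_bundle (quotient_atlas G) \<and> p \<in> fst d \<and> norm (\<xi> d) < 1"
    using disk_chart_cases[OF assms(2)] by metis
  obtain p \<xi> where x: "x = (p, \<xi>)" by (metis surj_pair)
  have p: "p \<in> fst c" "p \<in> fst d" "norm (\<xi> c) < 1" using assms x c d by auto
  obtain N L b where N: "open N" "snd c p \<in> N" "N \<subseteq> snd c ` (fst c \<inter> fst d)"
    "orthogonal_transformation L" "\<And>y. y \<in> N \<Longrightarrow> transition c d id y = L y + b"
    using quotient_transition[OF c(1) d(1) p(1,2)] by metis
  have lin: "bounded_linear L"
    using N(4) by (simp add: orthogonal_transformation_linear linear_conv_bounded_linear[symmetric])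
  have "bounded_linear (\<lambda>y. (L (fst y), L (snd y)))"
    by (intro bounded_linear_Pair bounded_linear_compose[OF lin] bounded_linear_fst bounded_linear_snd)
  then have bl: "bounded_linear (map_prod L L)" by (simp add: map_prod_def case_prod_unfold)
  have main: "y \<in> snd c' ` (fst c' \<inter> fst d') \<and> transition c' d' id y = map_prod L L y + (b, 0)"
    if yN: "y \<in> N \<times> ball 0 1" for y
  proof -
    obtain u a where y: "y = (u, a)" "u \<in> N" "norm a < 1" using yN by auto
    obtain q where q: "u = snd c q" "q \<in> fst c" "q \<in> fst d" using y N(3) by auto
    obtain \<eta> where eta: "(q, \<eta>) \<in> cotangent_bundle (quotient_atlas G)" "\<eta> c = a"
      using covector_exists[OF c(1) q(2)] by metis
    have "differential c d id q = L"
      by (rule differential_locally_affine[OF N(1) _ lin N(5)]) (use y q in auto)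
    then have ed: "\<eta> d = L a" using covector_component[OF eta(1) c(1) q(2) d(1) q(3)] eta by simp
    have "norm (\<eta> d) < 1" using ed y N(4) orthogonal_transformation_norm by metis
    then have mem: "(q, \<eta>) \<in> fst c'" "(q, \<eta>) \<in> fst d'" using c(3) d(3) eta q y by auto
    have yq: "snd c' (q, \<eta>) = y" using c(2) eta q y by simp
    then have "inv_into (fst c') (snd c') y = (q, \<eta>)"
      using inv_into_f_f[OF inj_disk_chart[OF assms(1)] mem(1)] by simp
    then have "transition c' d' id y = (snd d q, \<eta> d)" using d(2) by (simp add: transition_def)
    moreover have "snd d q = L u + b"
      using transition_id[OF c(1) q(2), of d] N(5)[OF y(2)] q by simp
    ultimately show ?thesis using mem yq ed y by (auto intro!: rev_image_eqI)
  qed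
  show ?thesis
  proof (rule that[of "N \<times> ball 0 1" L b])
    show "open (N \<times> ball (0::'e) 1)" using N by (simp add: open_Times)
    show "snd c' x \<in> N \<times> ball 0 1" using c(2) x N(2) p by simp
  qed (use main N bl in auto)
qed

end

lemma smooth_atlasI:
  assumes "\<And>c. c \<in> A \<Longrightarrow> inj_on (snd c) (fst c)"
    and "\<And>c d p. c \<in> A \<Longrightarrow> d \<in> A \<Longrightarrow> p \<in> fst c \<Longrightarrow> p \<in> fst d \<Longrightarrow>
      \<exists>N L b. open N \<and> snd c p \<in> N \<and> N \<subseteq> snd c ` (fst c \<inter> fst d) \<and> bounded_linear L \<and>
        (\<forall>y\<in>N. transition c d id y = L y + b)"
  shows "smooth_atlas A"
proof -
  have *: "open (snd c ` (fst c \<inter> fst d)) \<and> smooth_on (snd c ` (fst c \<inter> fst d)) (transition c d id)"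
    if cd: "c \<in> A" "d \<in> A" for c d
  proof -
    have *: "\<exists>N L b. open N \<and> x \<in> N \<and> N \<subseteq> snd c ` (fst c \<inter> fst d) \<and> bounded_linear L \<and>
        (\<forall>y\<in>N. transition c d id y = L y + b)" if "x \<in> snd c ` (fst c \<inter> fst d)" for x
      using that assms(2)[OF cd] by auto
    have "open (snd c ` (fst c \<inter> fst d))"
      unfolding open_subopen[of "snd c ` (fst c \<inter> fst d)"] using * by metis
    moreover have "smooth_on (snd c ` (fst c \<inter> fst d)) (transition c d id)"
      unfolding smooth_on_def by (intro allI Ck_on_locally_affine) (use * in metis)
    ultimately show ?thesis by simp
  qed
  then show ?thesis
    unfolding smooth_atlas_def using assms(1) *[of c c for c]
    by (auto simp: case_prod_beta)
qed

lemma isometry_groupI: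
  fixes G :: "(real \<times> real \<Rightarrow> real \<times> real) set"
  assumes "id \<in> G" "\<And>g h. g \<in> G \<Longrightarrow> h \<in> G \<Longrightarrow> g \<circ> h \<in> G"
    "\<And>g. g \<in> G \<Longrightarrow> \<exists>h\<in>G. h \<circ> g = id \<and> g \<circ> h = id"
    and *: "\<And>g. g \<in> G \<Longrightarrow> \<exists>m n. g = (\<lambda>(x, y). ((if even n then x else - x) + of_int m, y + of_int n / 2))"
  shows "isometry_group G"
  unfolding isometry_group_def
proof (intro conjI ballI allI)
  fix g assume "g \<in> G"
  then obtain m n where g: "g = (\<lambda>(x, y). ((if even n then x else - x) + of_int m, y + of_int n / 2))"
    using * by blast
  let ?L = "\<lambda>(x, y). (if even n then x else - x, y) :: real \<times> real"
  have "linear ?L" by (rule linearI) (auto simp: algebra_simps)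
  then have "orthogonal_transformation ?L"
    by (auto simp: orthogonal_transformation_def inner_prod_def)
  moreover have "g = (\<lambda>u. ?L u + (of_int m, of_int n / 2))" unfolding g by auto
  ultimately show "\<exists>L b. orthogonal_transformation L \<and> g = (\<lambda>u. L u + b)" by blast
next
  fix u :: "real \<times> real"
  have "inj_on (orbit_of G) (ball u (1/4))"
  proof (rule inj_onI)
    fix a b assume ab: "a \<in> ball u (1/4)" "b \<in> ball u (1/4)" "orbit_of G a = orbit_of G b"
    have "id b \<in> orbit_of G b" using assms(1) unfolding orbit_of_def by blast
    then have "b \<in> orbit_of G b" by simp
    then obtain g where "g \<in> G" "b = g a" using ab(3) unfolding orbit_of_def by auto
    then obtain m n where g: "b = ((if even n then fst a else - fst a) + of_int m, snd a + of_int n / 2)"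
      using * by (metis (no_types, lifting) case_prod_beta)
    have d: "dist a b < 1/2" using ab(1,2) dist_triangle2[of a b u] by (simp add: dist_commute)
    have "\<bar>snd a - snd b\<bar> < 1/2" using d dist_snd_le[of a b] by (simp add: dist_real_def)
    then have "\<bar>of_int n :: real\<bar> < 1" using g by auto
    then have n: "n = 0" by linarith
    have "\<bar>fst a - fst b\<bar> < 1/2" using d dist_fst_le[of a b] by (simp add: dist_real_def)
    then have "\<bar>of_int m :: real\<bar> < 1" using g n by auto
    then have "m = 0" by linarith
    then show "a = b" using g n by simp
  qed
  then show "\<exists>W. open W \<and> u \<in> W \<and> inj_on (orbit_of G) W"
    by (intro exI[of _ "ball u (1/4)"]) auto
qed (use assms in auto)

lemma isometry_group_torus: "isometry_group torus_group"
proof (rule isometry_groupI)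
  show "id \<in> torus_group"
    unfolding torus_group_def by (auto intro!: exI[of _ 0] simp: fun_eq_iff)
next
  fix g h assume "g \<in> torus_group" "h \<in> torus_group"
  then obtain m n m' n' :: int where "g = (\<lambda>(x, y). (x + of_int m, y + of_int n))"
    "h = (\<lambda>(x, y). (x + of_int m', y + of_int n'))"
    unfolding torus_group_def by auto
  then have "g \<circ> h = (\<lambda>(x, y). (x + of_int (m + m'), y + of_int (n + n')))"
    by (auto simp: fun_eq_iff)
  then show "g \<circ> h \<in> torus_group" unfolding torus_group_def by blast
next
  fix g assume "g \<in> torus_group"
  then obtain m n :: int where g: "g = (\<lambda>(x, y). (x + of_int m, y + of_int n))"
    unfolding torus_group_def by auto
  let ?h = "\<lambda>(x, y). (x + of_int (- m), y + of_int (- n)) :: real \<times> real"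
  have "?h \<in> torus_group" unfolding torus_group_def by blast
  moreover have "?h \<circ> g = id \<and> g \<circ> ?h = id" unfolding g by (auto simp: fun_eq_iff)
  ultimately show "\<exists>h\<in>torus_group. h \<circ> g = id \<and> g \<circ> h = id" by blast
next
  fix g assume "g \<in> torus_group"
  then obtain m n :: int where g: "g = (\<lambda>(x, y). (x + of_int m, y + of_int n))"
    unfolding torus_group_def by auto
  show "\<exists>m n. g = (\<lambda>(x, y). ((if even n then x else - x) + of_int m, y + of_int n / 2))"
    unfolding g by (intro exI[of _ m] exI[of _ "2 * n"]) auto
qed

lemma isometry_group_klein: "isometry_group klein_group"
proof -
  let ?B = "BijGroup (UNIV :: (real \<times> real) set)"
  let ?a = "\<lambda>(x, y). (x + 1, y) :: real \<times> real"
  let ?b = "\<lambda>(x, y). (1 - x, y + 1 / 2) :: real \<times> real"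
  interpret B: group ?B by (rule group_BijGroup)
  have carr: "carrier ?B = {f. bij f}" by (simp add: BijGroup_def Bij_def)
  have mult: "g \<otimes>\<^bsub>?B\<^esub> h = g \<circ> h" if "bij g" "bij h" for g h
    using that by (simp add: BijGroup_def Bij_def compose_def comp_def restrict_def)
  have one: "\<one>\<^bsub>?B\<^esub> = id" by (simp add: BijGroup_def id_def restrict_def)
  have "bij ?a" by (rule bij_betw_byWitness[of _ "\<lambda>(x, y). (x - 1, y)"]) auto
  moreover have "bij ?b" by (rule bij_betw_byWitness[of _ "\<lambda>(x, y). (1 - x, y - 1 / 2)"]) auto
  ultimately have gens: "{?a, ?b} \<subseteq> carrier ?B" using carr by auto
  have sub: "subgroup klein_group ?B"
    unfolding klein_group_def by (rule B.generate_is_subgroup[OF gens])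
  have bij: "bij g" if "g \<in> klein_group" for g
    using subgroup.mem_carrier[OF sub that] carr by simp
  have inv_eq: "inv\<^bsub>?B\<^esub> g = h" if "bij g" "bij h" "h \<circ> g = id" for g h
    using that B.inv_equality[of h g] mult one carr by simp
  show ?thesis
  proof (rule isometry_groupI)
    show "id \<in> klein_group" using subgroup.one_closed[OF sub] one by simp
    show "g \<circ> h \<in> klein_group" if "g \<in> klein_group" "h \<in> klein_group" for g h
      using subgroup.m_closed[OF sub that] mult bij that by simp
    show "\<exists>h\<in>klein_group. h \<circ> g = id \<and> g \<circ> h = id" if "g \<in> klein_group" for g
    proof -
      have i: "inv\<^bsub>?B\<^esub> g \<in> klein_group" using subgroup.m_inv_closed[OF sub that] .
      have "g \<in> carrier ?B" using carr bij that by simp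
      then have "inv\<^bsub>?B\<^esub> g \<otimes>\<^bsub>?B\<^esub> g = \<one>\<^bsub>?B\<^esub>" "g \<otimes>\<^bsub>?B\<^esub> inv\<^bsub>?B\<^esub> g = \<one>\<^bsub>?B\<^esub>" by simp_all
      then show ?thesis using i mult[OF bij bij] that one by metis
    qed
    show "\<exists>m n. g = (\<lambda>(x, y). ((if even n then x else - x) + of_int m, y + of_int n / 2))"
      if "g \<in> klein_group" for g
      using that unfolding klein_group_def
    proof (induction rule: generate.induct)
      case one
      show ?case unfolding \<open>\<one>\<^bsub>?B\<^esub> = id\<close> by (intro exI[of _ 0]) (auto simp: fun_eq_iff)
    next
      case (incl h)
      then consider "h = ?a" | "h = ?b" by blast
      then show ?case
      proof cases
        case 1 then show ?thesis by (intro exI[of _ 1] exI[of _ 0]) (auto simp: fun_eq_iff)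
      next
        case 2 then show ?thesis by (intro exI[of _ 1]) (auto simp: fun_eq_iff)
      qed
    next
      case (inv h)
      then consider "h = ?a" | "h = ?b" by blast
      then show ?case
      proof cases
        case 1
        have "inv\<^bsub>?B\<^esub> h = (\<lambda>(x, y). (x - 1, y))"
          unfolding 1 by (rule inv_eq[OF \<open>bij ?a\<close>])
            (auto intro!: bij_betw_byWitness[of _ ?a] simp: fun_eq_iff)
        then show ?thesis by (intro exI[of _ "-1"] exI[of _ 0]) (auto simp: fun_eq_iff)
      next
        case 2
        have "inv\<^bsub>?B\<^esub> h = (\<lambda>(x, y). (1 - x, y - 1 / 2))"
          unfolding 2 by (rule inv_eq[OF \<open>bij ?b\<close>])
            (auto intro!: bij_betw_byWitness[of _ ?b] simp: fun_eq_iff)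
        then show ?thesis by (intro exI[of _ 1] exI[of _ "-1"]) (auto simp: fun_eq_iff)
      qed
    next
      case (eng h1 h2)
      then obtain m n m' n' where
        h1: "h1 = (\<lambda>(x, y). ((if even n then x else - x) + of_int m, y + of_int n / 2))" and
        h2: "h2 = (\<lambda>(x, y). ((if even n' then x else - x) + of_int m', y + of_int n' / 2))"
        by blast
      have "h1 \<otimes>\<^bsub>?B\<^esub> h2 = h1 \<circ> h2"
        using eng.hyps bij mult unfolding klein_group_def by blast
      also have "\<dots> = (\<lambda>(x, y). ((if even (n + n') then x else - x) +
          of_int ((if even n then m' else - m') + m), y + of_int (n + n') / 2))"
        unfolding h1 h2 by (auto simp: fun_eq_iff add_divide_distrib)
      finally show ?case by blast
    qed
  qed
qed

lemmas smooth_atlas_torus = smooth_atlas_quotient[OF isometry_group_torus, folded torus_def]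
lemmas smooth_atlas_klein_bottle = smooth_atlas_quotient[OF isometry_group_klein, folded klein_bottle_def]
lemmas quotient_map_torus = quotient_map_quotient[OF isometry_group_torus, folded torus_def]
lemmas quotient_map_klein_bottle = quotient_map_quotient[OF isometry_group_klein, folded klein_bottle_def]
lemmas flat_metric_klein_bottle = flat_metric_quotient[OF isometry_group_klein, folded klein_bottle_def]

lemma smooth_atlas_DK: "smooth_atlas DK"
  unfolding DK_def klein_bottle_def
proof (rule smooth_atlasI, goal_cases)
  case (1 c) then show ?case by (rule inj_disk_chart[OF isometry_group_klein])
next
  case (2 c d p)
  then show ?case using disk_transition[OF isometry_group_klein] by metis
qed

lemma omega_st_DK: "pulls_back_to DK omega_st DK omega_st id"
  unfolding pulls_back_to_def
proof (intro ballI impI allI)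
  fix c d p v w assume cd: "c \<in> DK" "d \<in> DK" "p \<in> fst c" "id p \<in> fst d"
  obtain N L b where N: "open N" "snd c p \<in> N" "orthogonal_transformation L"
    "bounded_linear (map_prod L L)" "\<And>y. y \<in> N \<Longrightarrow> transition c d id y = map_prod L L y + (b, 0)"
    using disk_transition[OF isometry_group_klein cd(1)[unfolded DK_def klein_bottle_def]
        cd(2)[unfolded DK_def klein_bottle_def] cd(3) cd(4)[unfolded id_apply]] by metis
  have D: "differential c d id p = map_prod L L"
    by (rule differential_locally_affine[OF N(1,2,4,5)])
  have form: "omega_st e u v w = fst v \<bullet> snd w - fst w \<bullet> snd v"
    for e :: "('z, (real \<times> real) \<times> (real \<times> real)) chart" and u v w
    by (simp add: omega_st_def wedge_def inner_prod_def case_prod_beta)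
  show "omega_st d (snd d (id p)) (differential c d id p v) (differential c d id p w) =
        omega_st c (snd c p) v w"
    unfolding D form using N(3) by (simp add: orthogonal_transformation_def del: split_paired_All)
qed

lemma torus_transition:
  assumes "c \<in> torus" "d \<in> torus" "p \<in> fst c" "p \<in> fst d"
  obtains N b where "open N" "snd c p \<in> N" "N \<subseteq> snd c ` (fst c \<inter> fst d)"
    "\<And>y. y \<in> N \<Longrightarrow> transition c d id y = y + b"
proof -
  obtain N L b where N: "open N" "snd c p \<in> N" "N \<subseteq> snd c ` (fst c \<inter> fst d)"
    "\<And>y. y \<in> N \<Longrightarrow> transition c d id y = L y + b" "(\<lambda>u. L u + b) \<in> torus_group"
    using quotient_transition[OF isometry_group_torus] assms unfolding torus_def by metis
  obtain m n where "(\<lambda>u. L u + b) = (\<lambda>(x, y). (x + of_int m, y + of_int n))"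
    using N(5) unfolding torus_group_def by blast
  then have "L u + b = u + (of_int m, of_int n)" for u
    by (metis (no_types, lifting) add_Pair case_prod_beta prod.collapse)
  then show ?thesis using that N by metis
qed

lemma toric_chart_cases:
  assumes "c' \<in> toric_semidisk"
  obtains c where "c \<in> torus" "fst c' = semidisk \<times> fst c" "snd c' = map_prod id (snd c)"
    "inj_on (snd c') (fst c')"
proof -
  obtain c where c: "c \<in> torus" "fst c' = semidisk \<times> fst c" "snd c' = map_prod id (snd c)"
    using assms unfolding toric_semidisk_def prod_atlas_def open_submanifold_def euclidean_atlas_def
    by fastforce
  then have "inj_on (snd c) (fst c)"
    using inj_quotient_chart[OF isometry_group_torus] unfolding torus_def by blast
  then have "inj_on (snd c') (fst c')" unfolding c(2,3) by (intro map_prod_inj_on) auto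
  then show ?thesis using that c by blast
qed

lemma open_semidisk: "open semidisk"
proof -
  have eq: "semidisk = {u. (fst u)\<^sup>2 + (snd u)\<^sup>2 < 1} \<inter> {u. 0 < fst u}"
    unfolding semidisk_def by auto
  show ?thesis unfolding eq by (intro open_Int open_Collect_less continuous_intros)
qed

lemma toric_transition:
  assumes "c' \<in> toric_semidisk" "d' \<in> toric_semidisk" "x \<in> fst c'" "x \<in> fst d'"
  obtains N b where "open N" "snd c' x \<in> N" "N \<subseteq> snd c' ` (fst c' \<inter> fst d')"
    "\<And>y. y \<in> N \<Longrightarrow> transition c' d' id y = id y + (0, b)"
proof -
  obtain c where c: "c \<in> torus" "fst c' = semidisk \<times> fst c" "snd c' = map_prod id (snd c)"
    "inj_on (snd c') (fst c')"
    using toric_chart_cases[OF assms(1)] by metis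
  obtain d where d: "d \<in> torus" "fst d' = semidisk \<times> fst d" "snd d' = map_prod id (snd d)"
    using toric_chart_cases[OF assms(2)] by metis
  obtain i p where x: "x = (i, p)" "i \<in> semidisk" "p \<in> fst c" "p \<in> fst d"
    using assms c d by auto
  obtain N b where N: "open N" "snd c p \<in> N" "N \<subseteq> snd c ` (fst c \<inter> fst d)"
    "\<And>y. y \<in> N \<Longrightarrow> transition c d id y = y + b"
    using torus_transition[OF c(1) d(1) x(3,4)] by metis
  have main: "y \<in> snd c' ` (fst c' \<inter> fst d') \<and> transition c' d' id y = id y + (0, b)"
    if yN: "y \<in> semidisk \<times> N" for y
  proof -
    obtain j u where y: "y = (j, u)" "j \<in> semidisk" "u \<in> N" using yN by auto
    obtain q where q: "u = snd c q" "q \<in> fst c" "q \<in> fst d" using y N(3) by auto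
    have mem: "(j, q) \<in> fst c'" "(j, q) \<in> fst d'" using q c d y by auto
    have yq: "snd c' (j, q) = y" using c y q by simp
    then have "inv_into (fst c') (snd c') y = (j, q)" using inv_into_f_f[OF c(4) mem(1)] by simp
    then have "transition c' d' id y = (j, snd d q)" using d(3) by (simp add: transition_def)
    moreover have "snd d q = u + b"
      using transition_id[OF isometry_group_torus, of c q d] c(1) N(4)[OF y(3)] q
      unfolding torus_def by simp
    ultimately show ?thesis using mem yq y by (auto intro!: rev_image_eqI)
  qed
  show ?thesis
  proof (rule that[of "semidisk \<times> N" b])
    show "open (semidisk \<times> N)" using N open_semidisk by (simp add: open_Times)
    show "snd c' x \<in> semidisk \<times> N" using c(3) x N(2) by simp
  qed (use main in auto)
qed

lemma smooth_atlas_toric_semidisk: "smooth_atlas toric_semidisk"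
proof (rule smooth_atlasI, goal_cases)
  case (1 c) then show ?case using toric_chart_cases by metis
next
  case (2 c d p)
  then obtain N b where "open N" "snd c p \<in> N" "N \<subseteq> snd c ` (fst c \<inter> fst d)"
    "\<And>y. y \<in> N \<Longrightarrow> transition c d id y = id y + (0, b)"
    using toric_transition by metis
  moreover have "bounded_linear id" by (simp add: id_def bounded_linear_ident)
  ultimately show ?case by blast
qed

lemma omega_0_toric_semidisk: "pulls_back_to toric_semidisk omega_0 toric_semidisk omega_0 id"
  unfolding pulls_back_to_def
proof (intro ballI impI allI)
  fix c d p v w assume "c \<in> toric_semidisk" "d \<in> toric_semidisk" "p \<in> fst c" "id p \<in> fst d"
  then obtain N b where N: "open N" "snd c p \<in> N" "\<And>y. y \<in> N \<Longrightarrow> transition c d id y = id y + (0, b)"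
    using toric_transition[of c d p] by (metis id_apply)
  have "differential c d id p = id"
    by (rule differential_locally_affine[OF N(1,2) _ N(3)]) (simp add: id_def bounded_linear_ident)
  then show "omega_0 d (snd d (id p)) (differential c d id p v) (differential c d id p w) =
        omega_0 c (snd c p) v w"
    by (simp add: omega_0_def)
qed

end

theory Submission
  imports Defs
begin

text \<open>The torus is the orientation double cover of the Klein bottle, and the deck transformation acts
  on \<open>T\<^sup>*T\<^sup>2\<close> by \<open>(x, y, z, w) \<mapsto> (1 - x, y + 1/2, - z, w)\<close>. It exchanges the halves \<open>z > 0\<close> and
  \<open>z < 0\<close>, so the induced covering of cotangent bundles, a local symplectomorphism preserving the
  norm, is injective on \<open>z > 0\<close>; its restriction to the covectors of norm less than 1 there is the embedding. In charts
  this map is affine, which reduces all smoothness questions to linear algebra.\<close>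

section \<open>Maps that are affine isomorphisms in charts\<close>

lemma topspace_atlas_topology: "topspace (atlas_topology A) = atlas_carrier A"
proof -
  have "\<Union>{{p \<in> U. \<phi> p \<in> S} | U \<phi> S. (U, \<phi>) \<in> A \<and> open S} = atlas_carrier A"
    unfolding atlas_carrier_def by (auto intro: open_UNIV; blast)
  then show ?thesis unfolding atlas_topology_def topology_generated_by_topspace .
qed

lemma openin_atlas_topology_basic:
  assumes "c \<in> A" "open S"
  shows "openin (atlas_topology A) {p \<in> fst c. snd c p \<in> S}"
proof -
  have "(fst c, snd c) \<in> A" using assms(1) by simp
  then show ?thesis
    unfolding atlas_topology_def using assms(2) by (intro topology_generated_by_Basis) blast
qed

text \<open>Continuity into a generated topology can be tested on the generating sets, here the
  chart preimages of open sets, and openness of a preimage is a local property. The source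
  \<open>X\<close> is an arbitrary topology so that the criterion also serves the inverse of an
  embedding, whose source is a subspace.\<close>

lemma continuous_map_atlas_topologyI:
  assumes "f \<in> topspace X \<rightarrow> atlas_carrier B"
    and "\<And>d S x. \<lbrakk>d \<in> B; open S; x \<in> topspace X; f x \<in> fst d; snd d (f x) \<in> S\<rbrakk> \<Longrightarrow>
      \<exists>T. openin X T \<and> x \<in> T \<and> (\<forall>y\<in>T. f y \<in> fst d \<and> snd d (f y) \<in> S)"
  shows "continuous_map X (atlas_topology B) f"
  unfolding atlas_topology_def
proof (rule continuous_on_generated_topo)
  show "f ` topspace X \<subseteq> \<Union>{{p \<in> U. \<phi> p \<in> S} | U \<phi> S. (U, \<phi>) \<in> B \<and> open S}"
    using assms(1) topspace_atlas_topology[of B]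
    unfolding atlas_topology_def topology_generated_by_topspace by auto
next
  fix O' assume "O' \<in> {{p \<in> U. \<phi> p \<in> S} | U \<phi> S. (U, \<phi>) \<in> B \<and> open S}"
  then obtain d S where d: "d \<in> B" "open S" "O' = {p \<in> fst d. snd d p \<in> S}" by force
  have "\<exists>T. openin X T \<and> x \<in> T \<and> T \<subseteq> f -` O' \<inter> topspace X" if "x \<in> f -` O' \<inter> topspace X" for x
  proof -
    have "x \<in> topspace X" "f x \<in> fst d" "snd d (f x) \<in> S" using that d(3) by auto
    then obtain T where "openin X T" "x \<in> T" "\<forall>y\<in>T. f y \<in> fst d \<and> snd d (f y) \<in> S"
      using assms(2)[OF d(1,2), of x] by blast
    then show ?thesis using openin_subset[of X T] d(3) by (intro exI[of _ T]) auto
  qed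
  then show "openin X (f -` O' \<inter> topspace X)"
    using openin_subopen[of X "f -` O' \<inter> topspace X"] by blast
qed

text \<open>The inclusion satisfied by \<open>N\<close> gives the affine formula its meaning:
  \<open>transition\<close> is built with \<open>inv_into\<close> and has values everywhere, but
  only on coordinates of points that \<open>f\<close> sends into \<open>d\<close> do they describe
  \<open>f\<close>. The linear part \<open>L\<close> is a parameter because it is the differential,
  which the symplectic condition refers to.\<close>

definition affine_iso_at ::
  "('m, 'e::euclidean_space) chart \<Rightarrow> ('n, 'f::euclidean_space) chart \<Rightarrow> ('m \<Rightarrow> 'n) \<Rightarrow> 'm \<Rightarrow>
   ('e \<Rightarrow> 'f) \<Rightarrow> bool" where
  "affine_iso_at c d f p L \<longleftrightarrow> linear L \<and> bij L \<and>
     (\<exists>N b. open N \<and> snd c p \<in> N \<and> N \<subseteq> snd c ` {q \<in> fst c. f q \<in> fst d} \<and>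
        (\<forall>y\<in>N. transition c d f y = L y + b))"

text \<open>An injective chart cancels the \<open>inv_into\<close> hidden in
  \<open>transition\<close>, which turns the condition on coordinates into one on points of the
  manifold.\<close>

lemma affine_iso_atE:
  assumes "affine_iso_at c d f p L" and inj: "inj_on (snd c) (fst c)"
  obtains N b where "linear L" "bij L" "open N" "snd c p \<in> N"
    "\<And>q. q \<in> fst c \<Longrightarrow> snd c q \<in> N \<Longrightarrow> f q \<in> fst d \<and> snd d (f q) = L (snd c q) + b"
    "\<And>y. y \<in> N \<Longrightarrow> \<exists>q\<in>fst c. y = snd c q"
proof -
  obtain N b where N: "linear L" "bij L" "open N" "snd c p \<in> N"
    "N \<subseteq> snd c ` {q \<in> fst c. f q \<in> fst d}" "\<forall>y\<in>N. transition c d f y = L y + b"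
    using assms(1) unfolding affine_iso_at_def by blast
  show ?thesis
  proof (rule that[OF N(1-4)])
    fix q assume q: "q \<in> fst c" "snd c q \<in> N"
    then obtain r where "r \<in> fst c" "f r \<in> fst d" "snd c q = snd c r" using N(5) by blast
    then have "f q \<in> fst d" using inj_onD[OF inj] q by metis
    moreover have "inv_into (fst c) (snd c) (snd c q) = q" by (rule inv_into_f_f[OF inj q(1)])
    ultimately show "f q \<in> fst d \<and> snd d (f q) = L (snd c q) + b"
      using N(6)[rule_format, OF q(2)] by (simp add: transition_def)
  qed (use N in auto)
qed

lemma differential_affine_iso:
  assumes "affine_iso_at c d f p L"
  shows "differential c d f p = L"
proof -
  obtain N b where N: "linear L" "open N" "snd c p \<in> N" "\<And>y. y \<in> N \<Longrightarrow> transition c d f y = L y + b"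
    using assms unfolding affine_iso_at_def by blast
  show ?thesis
    by (rule differential_locally_affine[OF N(2,3) _ N(4)])
       (use N(1) in \<open>simp_all add: linear_conv_bounded_linear\<close>)
qed

lemma continuous_linear_plus:
  fixes L :: "'e::euclidean_space \<Rightarrow> 'f::euclidean_space"
  assumes "linear L"
  shows "continuous_on UNIV (\<lambda>y. L y + b)"
  using assms
  by (intro continuous_intros linear_continuous_on) (simp add: linear_conv_bounded_linear[symmetric])

lemma open_bij_linear_plus_image:
  fixes L :: "'e::euclidean_space \<Rightarrow> 'f::euclidean_space"
  assumes "linear L" "bij L" "open S"
  shows "open ((\<lambda>y. L y + b) ` S)"
proof -
  have "open (L ` S)" using assms bij_is_surj by (intro open_surjective_linear_image) auto
  then have "open ((+) b ` L ` S)" by (rule open_translation)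
  then show ?thesis by (simp add: image_image add.commute)
qed

text \<open>In charts \<open>f\<close> is locally an affine isomorphism. Such a map is smooth, its
  differential is the injective map \<open>L\<close>, and it is continuous and open, so
  \<open>f\<close> is a local homeomorphism onto its image. Injectivity on the whole carrier then
  makes the inverse globally defined and continuous.\<close>

lemma smooth_embedding_if_affine_iso:
  fixes A :: "('m, 'e::euclidean_space) atlas" and B :: "('n, 'f::euclidean_space) atlas"
  assumes A: "smooth_atlas A" and B: "smooth_atlas B"
    and carrier: "f \<in> atlas_carrier A \<rightarrow> atlas_carrier B" and inj: "inj_on f (atlas_carrier A)"
    and loc: "\<And>c d p. \<lbrakk>c \<in> A; d \<in> B; p \<in> fst c; f p \<in> fst d\<rbrakk> \<Longrightarrow> \<exists>L. affine_iso_at c d f p L"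
  shows "smooth_embedding A B f"
proof -
  have injA: "inj_on (snd c) (fst c)" if "c \<in> A" for c
    using A that unfolding smooth_atlas_def by (auto simp: case_prod_beta)
  have injB: "inj_on (snd d) (fst d)" if "d \<in> B" for d
    using B that unfolding smooth_atlas_def by (auto simp: case_prod_beta)
  have memA: "p \<in> atlas_carrier A \<longleftrightarrow> (\<exists>c\<in>A. p \<in> fst c)" for p
    unfolding atlas_carrier_def by (auto simp: case_prod_beta)
  have memB: "p \<in> atlas_carrier B \<longleftrightarrow> (\<exists>c\<in>B. p \<in> fst c)" for p
    unfolding atlas_carrier_def by (auto simp: case_prod_beta)
  have cont: "continuous_map (atlas_topology A) (atlas_topology B) f"
  proof (rule continuous_map_atlas_topologyI)
    show "f \<in> topspace (atlas_topology A) \<rightarrow> atlas_carrier B"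
      using carrier by (simp add: topspace_atlas_topology)
  next
    fix d S x
    assume *: "d \<in> B" "open S" "x \<in> topspace (atlas_topology A)" "f x \<in> fst d" "snd d (f x) \<in> S"
    then obtain c where c: "c \<in> A" "x \<in> fst c" using memA topspace_atlas_topology by metis
    obtain L where "affine_iso_at c d f x L" using loc c * by metis
    then obtain N b where N: "linear L" "open N" "snd c x \<in> N"
      "\<And>q. q \<in> fst c \<Longrightarrow> snd c q \<in> N \<Longrightarrow> f q \<in> fst d \<and> snd d (f q) = L (snd c q) + b"
      using injA[OF c(1)] by (elim affine_iso_atE) auto
    let ?T = "{q \<in> fst c. snd c q \<in> N \<inter> (\<lambda>y. L y + b) -` S}"
    have "open (N \<inter> (\<lambda>y. L y + b) -` S)"
      using N(2) *(2) continuous_linear_plus[OF N(1)] by (intro open_Int open_vimage) auto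
    then have "openin (atlas_topology A) ?T" by (rule openin_atlas_topology_basic[OF c(1)])
    moreover have "x \<in> ?T" using c N(3) N(4)[OF c(2)] *(5) by auto
    moreover have "\<forall>y\<in>?T. f y \<in> fst d \<and> snd d (f y) \<in> S" using N(4) by auto
    ultimately show "\<exists>T. openin (atlas_topology A) T \<and> x \<in> T \<and> (\<forall>y\<in>T. f y \<in> fst d \<and> snd d (f y) \<in> S)"
      by blast
  qed
  let ?Y = "subtopology (atlas_topology B) (f ` atlas_carrier A)"
  let ?g = "inv_into (atlas_carrier A) f"
  have topY: "topspace ?Y = f ` atlas_carrier A"
    using carrier by (auto simp: topspace_atlas_topology)
  have g: "?g (f q) = q" if "q \<in> atlas_carrier A" for q using that inj by simp
  have contg: "continuous_map ?Y (atlas_topology A) ?g"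
  proof (rule continuous_map_atlas_topologyI)
    show "?g \<in> topspace ?Y \<rightarrow> atlas_carrier A" unfolding topY using g by auto
  next
    fix c S x
    assume *: "c \<in> A" "open S" "x \<in> topspace ?Y" "?g x \<in> fst c" "snd c (?g x) \<in> S"
    then obtain p where p: "p \<in> atlas_carrier A" "x = f p" unfolding topY by auto
    have pc: "p \<in> fst c" "snd c p \<in> S" using * p g by auto
    obtain d where d: "d \<in> B" "f p \<in> fst d" using p carrier memB by blast
    obtain L where "affine_iso_at c d f p L" using loc pc d * by metis
    then obtain N b where N: "linear L" "bij L" "open N" "snd c p \<in> N"
      "\<And>q. q \<in> fst c \<Longrightarrow> snd c q \<in> N \<Longrightarrow> f q \<in> fst d \<and> snd d (f q) = L (snd c q) + b"
      "\<And>y. y \<in> N \<Longrightarrow> \<exists>q\<in>fst c. y = snd c q"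
      using injA[OF *(1)] by (elim affine_iso_atE) auto
    \<comment> \<open>Affine isomorphisms are open, so the image of a coordinate neighbourhood of
      \<open>p\<close> is again a coordinate neighbourhood of \<open>f p\<close>, and on it the
      inverse of \<open>f\<close> is controlled.\<close>
    let ?T = "{r \<in> fst d. snd d r \<in> (\<lambda>y. L y + b) ` (N \<inter> S)}"
    have "openin (atlas_topology B) ?T"
      using N *(2) by (intro openin_atlas_topology_basic d open_bij_linear_plus_image open_Int)
    then have "openin ?Y (f ` atlas_carrier A \<inter> ?T)" by (rule openin_subtopology_Int2)
    moreover have "x \<in> f ` atlas_carrier A \<inter> ?T" using p d pc N(4) N(5)[OF pc(1)] by auto
    moreover have "?g y \<in> fst c \<and> snd c (?g y) \<in> S" if "y \<in> f ` atlas_carrier A \<inter> ?T" for y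
    proof -
      obtain v where v: "v \<in> N" "v \<in> S" "snd d y = L v + b" "y \<in> fst d" using \<open>y \<in> _\<close> by auto
      obtain q where q: "q \<in> fst c" "v = snd c q" using N(6) v(1) by blast
      have "f q \<in> fst d" "snd d (f q) = snd d y" using N(5)[OF q(1)] v q by auto
      \<comment> \<open>\<open>y\<close> and \<open>f q\<close> have the same coordinates in the
        injective chart \<open>d\<close>; hence the preimage of \<open>y\<close> is the point
        \<open>q\<close>, whose coordinates in \<open>c\<close> are known.\<close>
      then have "y = f q" using inj_onD[OF injB[OF d(1)]] v(4) by metis
      moreover have "q \<in> atlas_carrier A" using memA q *(1) by blast
      ultimately show ?thesis using g v q by simp
    qed
    ultimately show "\<exists>T. openin ?Y T \<and> x \<in> T \<and> (\<forall>y\<in>T. ?g y \<in> fst c \<and> snd c (?g y) \<in> S)"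
      by blast
  qed
  have "homeomorphic_maps (atlas_topology A) ?Y f ?g"
    unfolding homeomorphic_maps_def using cont contg g topY
    by (auto simp: continuous_map_in_subtopology topspace_atlas_topology)
  then have emb: "embedding_map (atlas_topology A) (atlas_topology B) f"
    unfolding embedding_map_def topspace_atlas_topology homeomorphic_map_maps by blast
  have "smooth_on (snd c ` {p \<in> fst c. f p \<in> fst d}) (transition c d f)" if "c \<in> A" "d \<in> B" for c d
    unfolding smooth_on_def
  proof (intro allI Ck_on_locally_affine)
    fix x assume "x \<in> snd c ` {p \<in> fst c. f p \<in> fst d}"
    then obtain p where p: "p \<in> fst c" "f p \<in> fst d" "x = snd c p" by blast
    show "\<exists>N L b. open N \<and> x \<in> N \<and> bounded_linear L \<and> (\<forall>y\<in>N. transition c d f y = L y + b)"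
      using loc[OF that p(1,2)] p(3) unfolding affine_iso_at_def linear_conv_bounded_linear by metis
  qed
  then have "smooth_map A B f" unfolding smooth_map_def using cont by (auto simp: case_prod_beta)
  moreover have "inj (differential c d f p)"
    if cd: "c \<in> A" "d \<in> B" "p \<in> fst c" "f p \<in> fst d" for c d p
  proof -
    obtain L where L: "affine_iso_at c d f p L" using loc[OF cd] by blast
    then have "inj L" unfolding affine_iso_at_def using bij_is_inj by blast
    then show ?thesis unfolding differential_affine_iso[OF L] .
  qed
  ultimately show ?thesis unfolding smooth_embedding_def smooth_immersion_def using emb by blast
qed

section \<open>Covectors on quotients of Euclidean space\<close>

text \<open>The image of the covector \<open>a\<close> at \<open>u\<close> under the covering map \<open>orbit_of G\<close>; its component in a
  chart is well defined because the chart composed with the covering map is locally an isometry.\<close>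

definition quotient_covector ::
  "('e::euclidean_space \<Rightarrow> 'e) set \<Rightarrow> 'e \<Rightarrow> 'e \<Rightarrow> ('e set, 'e) covector" where
  "quotient_covector G u a =
     (orbit_of G u,
      restrict (\<lambda>d. frechet_derivative (snd d \<circ> orbit_of G) (at u) a)
        {d \<in> quotient_atlas G. orbit_of G u \<in> fst d})"

lemma quotient_chart_cases:
  assumes "c \<in> quotient_atlas G"
  obtains W where "open W" "fst c = orbit_of G ` W" "\<And>u. u \<in> W \<Longrightarrow> snd c (orbit_of G u) = u"
proof -
  obtain W where "open W" "inj_on (orbit_of G) W" "c = (orbit_of G ` W, inv_into W (orbit_of G))"
    using assms unfolding quotient_atlas_def by blast
  then show ?thesis by (intro that[of W]) auto
qed

context
  fixes G :: "('e::euclidean_space \<Rightarrow> 'e) set"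
  assumes G: "isometry_group G"
begin

lemma orbit_of_eq_iff: "orbit_of G u = orbit_of G v \<longleftrightarrow> (\<exists>g\<in>G. v = g u)"
proof
  assume *: "orbit_of G u = orbit_of G v"
  have "v \<in> orbit_of G v"
    using G unfolding isometry_group_def orbit_of_def by (metis (mono_tags, lifting) id_apply mem_Collect_eq)
  with * show "\<exists>g\<in>G. v = g u" unfolding orbit_of_def by auto
next
  have sub: "orbit_of G (g w) \<subseteq> orbit_of G w" if "g \<in> G" for g w
  proof
    fix z assume "z \<in> orbit_of G (g w)"
    then obtain h where h: "h \<in> G" "z = h (g w)" unfolding orbit_of_def by auto
    then have "h \<circ> g \<in> G" using G \<open>g \<in> G\<close> unfolding isometry_group_def by simp
    then have "(h \<circ> g) w \<in> orbit_of G w" unfolding orbit_of_def by blast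
    then show "z \<in> orbit_of G w" using h(2) by simp
  qed
  assume "\<exists>g\<in>G. v = g u"
  then obtain g where g: "g \<in> G" "v = g u" by auto
  then obtain h where "h \<in> G" "h \<circ> g = id" using G unfolding isometry_group_def by metis
  then have "h v = u" using g by (metis comp_apply id_apply)
  then show "orbit_of G u = orbit_of G v"
    using sub[of g u] sub[of h v] g \<open>h \<in> G\<close> by auto
qed

lemma quotient_chart_covers:
  obtains c where "c \<in> quotient_atlas G" "orbit_of G u \<in> fst c"
proof -
  obtain W where "open W" "u \<in> W" "inj_on (orbit_of G) W"
    using G unfolding isometry_group_def by blast
  then show ?thesis
    by (intro that[of "(orbit_of G ` W, inv_into W (orbit_of G))"]) (auto simp: quotient_atlas_def)
qed

text \<open>A chart inverts the projection on one sheet \<open>W\<close>, while \<open>u\<close> may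
  lie on another sheet. Some \<open>g\<close> in \<open>G\<close> carries \<open>u\<close> into
  \<open>W\<close>, and near \<open>u\<close> the chart composed with the projection is this
  \<open>g\<close>, an affine isometry.\<close>

lemma chart_orbit_locally_affine:
  assumes "d \<in> quotient_atlas G" "orbit_of G u \<in> fst d"
  obtains N L b where "open N" "u \<in> N" "orthogonal_transformation L"
    "\<And>y. y \<in> N \<Longrightarrow> orbit_of G y \<in> fst d"
    "\<And>y. y \<in> N \<Longrightarrow> snd d (orbit_of G y) = L y + b"
    "\<And>y. y \<in> N \<Longrightarrow> ((snd d \<circ> orbit_of G) has_derivative L) (at y)"
proof -
  obtain W where W: "open W" "fst d = orbit_of G ` W" "\<And>u. u \<in> W \<Longrightarrow> snd d (orbit_of G u) = u"
    using quotient_chart_cases[OF assms(1)] by metis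
  obtain w where w: "w \<in> W" "orbit_of G u = orbit_of G w" using W assms by auto
  obtain g where g: "g \<in> G" "w = g u" using w orbit_of_eq_iff by metis
  obtain L b where L: "orthogonal_transformation L" "g = (\<lambda>u. L u + b)"
    using G g unfolding isometry_group_def by metis
  have o: "orbit_of G (g y) = orbit_of G y" for y using orbit_of_eq_iff g(1) by metis
  have lin: "linear L" using L(1) by (rule orthogonal_transformation_linear)
  have opn: "open (g -` W)"
    unfolding L(2) using W(1) continuous_linear_plus[OF lin] by (rule open_vimage)
  have chart: "snd d (orbit_of G y) = L y + b" if "y \<in> g -` W" for y
    using that W(3)[of "g y"] o[of y] L(2) by simp
  show ?thesis
  proof (rule that[OF opn _ L(1) _ chart])
    show "u \<in> g -` W" using g w by simp
    show "orbit_of G y \<in> fst d" if "y \<in> g -` W" for y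
      using that o[of y] W(2) by (metis imageI vimageD)
    show "((snd d \<circ> orbit_of G) has_derivative L) (at y)" if y: "y \<in> g -` W" for y
    proof -
      have "((\<lambda>y. L y + b) has_derivative L) (at y)"
        using lin unfolding linear_conv_bounded_linear
        by (auto intro!: derivative_eq_intros bounded_linear_imp_has_derivative)
      then show ?thesis
        by (rule has_derivative_transform_within_open[OF _ opn y]) (use chart in auto)
    qed
  qed auto
qed

lemma chart_orbit_derivative:
  assumes "d \<in> quotient_atlas G" "orbit_of G u \<in> fst d"
  shows "((snd d \<circ> orbit_of G) has_derivative frechet_derivative (snd d \<circ> orbit_of G) (at u)) (at u)"
    and "orthogonal_transformation (frechet_derivative (snd d \<circ> orbit_of G) (at u))"
proof -
  obtain L where ort: "orthogonal_transformation L"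
    and der: "((snd d \<circ> orbit_of G) has_derivative L) (at u)"
    by (rule chart_orbit_locally_affine[OF assms]) blast
  have L: "frechet_derivative (snd d \<circ> orbit_of G) (at u) = L"
    using frechet_derivative_at[OF der] by simp
  show "((snd d \<circ> orbit_of G) has_derivative frechet_derivative (snd d \<circ> orbit_of G) (at u)) (at u)"
    unfolding L by (rule der)
  show "orthogonal_transformation (frechet_derivative (snd d \<circ> orbit_of G) (at u))"
    unfolding L by (rule ort)
qed

text \<open>The transformation law is the chain rule for the chart \<open>d\<close> factored through
  the chart \<open>c\<close>. Components are vectors paired by the inner product; as the change of
  charts has an orthogonal differential, pushing such a vector forward is the same as transporting
  the covector it represents.\<close>

lemma quotient_covector_in_bundle: "quotient_covector G u a \<in> cotangent_bundle (quotient_atlas G)"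
proof -
  let ?D = "\<lambda>c. frechet_derivative (snd c \<circ> orbit_of G) (at u)"
  let ?p = "orbit_of G u"
  have law: "?D c a \<bullet> v = ?D d a \<bullet> differential c d id ?p v"
    if cd: "c \<in> quotient_atlas G" "d \<in> quotient_atlas G" "?p \<in> fst c" "?p \<in> fst d" for c d v
  proof -
    let ?L = "differential c d id ?p"
    obtain N b where N: "open N" "snd c ?p \<in> N" "orthogonal_transformation ?L"
      "\<And>y. y \<in> N \<Longrightarrow> transition c d id y = ?L y + b"
      using quotient_differential[OF G cd] by metis
    have "((\<lambda>y. ?L y + b) has_derivative ?L) (at (snd c ?p))"
      using N(3)[THEN orthogonal_transformation_linear] unfolding linear_conv_bounded_linear
      by (auto intro!: derivative_eq_intros bounded_linear_imp_has_derivative)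
    then have "(transition c d id has_derivative ?L) (at (snd c ?p))"
      by (rule has_derivative_transform_within_open[OF _ N(1,2)]) (use N(4) in auto)
    then have "(transition c d id has_derivative ?L) (at ((snd c \<circ> orbit_of G) u))" by simp
    from diff_chain_at[OF chart_orbit_derivative(1)[OF cd(1,3)] this]
    have *: "((transition c d id \<circ> (snd c \<circ> orbit_of G)) has_derivative (?L \<circ> ?D c)) (at u)" .
    \<comment> \<open>The factorization through \<open>c\<close> holds only where the projection
      lands in the domain of \<open>c\<close>, so the derivative is compared on a neighbourhood of
      \<open>u\<close> with this property.\<close>
    obtain M where M: "open M" "u \<in> M" "\<And>y. y \<in> M \<Longrightarrow> orbit_of G y \<in> fst c"
      using chart_orbit_locally_affine[OF cd(1,3)] by metis
    have "((snd d \<circ> orbit_of G) has_derivative (?L \<circ> ?D c)) (at u)"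
      by (rule has_derivative_transform_within_open[OF * M(1,2)])
         (simp add: transition_id[OF G cd(1) M(3)])
    then have "?D d = ?L \<circ> ?D c" by (rule frechet_derivative_at[symmetric])
    then show ?thesis using N(3) by (simp add: orthogonal_transformation_def)
  qed
  let ?\<xi> = "restrict (\<lambda>d. ?D d a) {d \<in> quotient_atlas G. ?p \<in> fst d}"
  have restricted_law: "?\<xi> c \<bullet> v = ?\<xi> d \<bullet> differential c d id ?p v"
    if "c \<in> quotient_atlas G" "d \<in> quotient_atlas G" "?p \<in> fst c" "?p \<in> fst d" for c d v
    using law[OF that, of v] that by simp
  have "?p \<in> atlas_carrier (quotient_atlas G)"
    using quotient_chart_covers[of u] unfolding atlas_carrier_def by (auto simp: case_prod_beta)
  then show ?thesis
    unfolding cotangent_bundle_def quotient_covector_def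
    by (intro CollectI case_prodI conjI ballI impI allI restrict_extensional restricted_law) blast+
qed

text \<open>The projection is invariant under the group element; differentiating this identity at
  \<open>u\<close> relates the derivative at the moved point, precomposed with \<open>L\<close>, to
  the derivative at \<open>u\<close>.\<close>

lemma quotient_covector_equivariant:
  assumes "(\<lambda>u. L u + b) \<in> G" "orthogonal_transformation L"
  shows "quotient_covector G (L u + b) (L a) = quotient_covector G u a"
proof -
  have o: "orbit_of G (L y + b) = orbit_of G y" for y
    using orbit_of_eq_iff[of y "L y + b"] assms(1) by force
  have "frechet_derivative (snd d \<circ> orbit_of G) (at (L u + b)) (L a) =
      frechet_derivative (snd d \<circ> orbit_of G) (at u) a"
    if d: "d \<in> quotient_atlas G" "orbit_of G u \<in> fst d" for d
  proof -
    let ?D = "frechet_derivative (snd d \<circ> orbit_of G) (at (L u + b))"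
    have "((\<lambda>y. L y + b) has_derivative L) (at u)"
      using assms(2)[THEN orthogonal_transformation_linear] unfolding linear_conv_bounded_linear
      by (auto intro!: derivative_eq_intros bounded_linear_imp_has_derivative)
    moreover have "((snd d \<circ> orbit_of G) has_derivative ?D) (at (L u + b))"
      using chart_orbit_derivative(1)[OF d(1), of "L u + b"] d(2) o by simp
    ultimately have "(((snd d \<circ> orbit_of G) \<circ> (\<lambda>y. L y + b)) has_derivative (?D \<circ> L)) (at u)"
      by (rule diff_chain_at)
    moreover have "(snd d \<circ> orbit_of G) \<circ> (\<lambda>y. L y + b) = snd d \<circ> orbit_of G" using o by auto
    ultimately have "?D \<circ> L = frechet_derivative (snd d \<circ> orbit_of G) (at u)"
      by (simp add: frechet_derivative_at)
    then show ?thesis by (metis comp_apply)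
  qed
  then show ?thesis unfolding quotient_covector_def o by (auto intro!: restrict_ext)
qed

text \<open>Equality of base points supplies the group element. Equivariance moves both covectors to
  the common point \<open>v\<close>, where a single chart separates them because its derivative is
  injective.\<close>

lemma quotient_covector_eqD:
  assumes "quotient_covector G u a = quotient_covector G v b"
  obtains L t where "(\<lambda>u. L u + t) \<in> G" "orthogonal_transformation L" "v = L u + t" "b = L a"
proof -
  have "orbit_of G u = orbit_of G v" using assms unfolding quotient_covector_def by simp
  then obtain g where g: "g \<in> G" "v = g u" using orbit_of_eq_iff by metis
  then obtain L t where L: "orthogonal_transformation L" "g = (\<lambda>u. L u + t)"
    using G unfolding isometry_group_def by metis
  have eq: "quotient_covector G v (L a) = quotient_covector G v b"
    using quotient_covector_equivariant[of L t u a] assms g L by simp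
  obtain d where d: "d \<in> quotient_atlas G" "orbit_of G v \<in> fst d"
    using quotient_chart_covers by metis
  let ?D = "frechet_derivative (snd d \<circ> orbit_of G) (at v)"
  have "?D (L a) = ?D b"
    using arg_cong[OF eq, of "\<lambda>x. snd x d"] d by (simp add: quotient_covector_def)
  then have "L a = b"
    using chart_orbit_derivative(2)[OF d] orthogonal_transformation_inj by (metis injD)
  then show ?thesis using that[of L t] g L by simp
qed

text \<open>The components in all charts arise from \<open>a\<close> by orthogonal maps, and the
  dual norm of the flat metric is the Euclidean norm, so the bound holds in every chart at
  once.\<close>

lemma quotient_covector_in_disk_bundle:
  assumes "norm a < 1"
  shows "quotient_covector G u a \<in>
    atlas_carrier (unit_disk_cotangent_bundle (quotient_atlas G) flat_metric)"
proof -
  obtain d where d: "d \<in> quotient_atlas G" "orbit_of G u \<in> fst d"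
    using quotient_chart_covers by metis
  let ?c = "cotangent_chart (quotient_atlas G) d"
  let ?W = "{(p, \<xi>). \<forall>c\<in>quotient_atlas G. p \<in> fst c \<longrightarrow>
     dual_norm (flat_metric c (snd c p)) (\<xi> c) < 1} :: ('e set, 'e) covector set"
  have "norm (frechet_derivative (snd c \<circ> orbit_of G) (at u) a) < 1"
    if "c \<in> quotient_atlas G" "orbit_of G u \<in> fst c" for c
    using chart_orbit_derivative(2)[OF that] assms orthogonal_transformation_norm by metis
  then have "quotient_covector G u a \<in> ?W"
    by (simp add: quotient_covector_def dual_norm_flat[OF G])
  moreover have "quotient_covector G u a \<in> fst ?c"
    using quotient_covector_in_bundle[of u a] d by (simp add: cotangent_chart_def quotient_covector_def)
  moreover have "(fst ?c \<inter> ?W, snd ?c) \<in> unit_disk_cotangent_bundle (quotient_atlas G) flat_metric"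
    unfolding unit_disk_cotangent_bundle_def open_submanifold_def cotangent_atlas_def
    by (intro CollectI exI[of _ "fst ?c"] exI[of _ "snd ?c"] conjI refl) (use d(1) in simp)
  ultimately show ?thesis
    unfolding atlas_carrier_def by (intro UN_I[of "(fst ?c \<inter> ?W, snd ?c)"]) (simp_all only: prod.case IntI)
qed

end

section \<open>The double cover of the Klein bottle by the torus\<close>

text \<open>The maps of this form are a subgroup containing both generators, hence contain the group
  they generate. The number \<open>n\<close> counts half translations in \<open>y\<close>, each of
  which comes with a reversal of \<open>x\<close>.\<close>

lemma klein_group_elem:
  assumes "g \<in> klein_group"
  shows "\<exists>m n. g = (\<lambda>(x, y). ((if even n then x else - x) + of_int m, y + of_int n / 2))"
proof -
  let ?B = "BijGroup (UNIV :: (real \<times> real) set)"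
  let ?a = "\<lambda>(x, y). (x + 1, y) :: real \<times> real"
  let ?b = "\<lambda>(x, y). (1 - x, y + 1 / 2) :: real \<times> real"
  define k :: "int \<Rightarrow> int \<Rightarrow> real \<times> real \<Rightarrow> real \<times> real"
    where "k = (\<lambda>m n (x, y). ((if even n then x else - x) + of_int m, y + of_int n / 2))"
  let ?H = "{k m n | m n. True}"
  interpret B: group ?B by (rule group_BijGroup)
  have comp: "k m n \<circ> k m' n' = k ((if even n then m' else - m') + m) (n + n')" for m n m' n'
    unfolding k_def by (auto simp: fun_eq_iff add_divide_distrib)
  have k0: "k 0 0 = id" unfolding k_def by (auto simp: fun_eq_iff)
  \<comment> \<open>For odd \<open>n\<close> the first coordinate undergoes a reflection, which is
    its own inverse; this is why \<open>m\<close> keeps its sign in that case.\<close>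
  have inv: "k (if even n then - m else m) (- n) \<circ> k m n = id"
    "k m n \<circ> k (if even n then - m else m) (- n) = id" for m n
    unfolding comp by (auto simp: k_def fun_eq_iff)
  have carr: "k m n \<in> carrier ?B" for m n
    using o_bij[OF inv] by (simp add: BijGroup_def Bij_def)
  have mult: "k m n \<otimes>\<^bsub>?B\<^esub> k m' n' = k m n \<circ> k m' n'" for m n m' n'
    using carr by (simp add: BijGroup_def Bij_def compose_def comp_def restrict_def)
  have one: "\<one>\<^bsub>?B\<^esub> = k 0 0" unfolding k0 by (simp add: BijGroup_def id_def restrict_def)
  have inv_eq: "inv\<^bsub>?B\<^esub> (k m n) = k (if even n then - m else m) (- n)" for m n
    by (rule B.inv_equality) (use carr inv in \<open>simp_all only: mult one k0\<close>)
  have "subgroup ?H ?B"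
  proof
    show "?H \<subseteq> carrier ?B" using carr by blast
    show "x \<otimes>\<^bsub>?B\<^esub> y \<in> ?H" if "x \<in> ?H" "y \<in> ?H" for x y
      using that by (clarsimp simp only: mult comp) blast
    show "\<one>\<^bsub>?B\<^esub> \<in> ?H" using one by blast
    show "inv\<^bsub>?B\<^esub> x \<in> ?H" if "x \<in> ?H" for x
      using that by (clarsimp simp only: inv_eq) blast
  qed
  moreover have "?a = k 1 0" "?b = k 1 1" unfolding k_def by (auto simp: fun_eq_iff)
  then have "{?a, ?b} \<subseteq> ?H" by blast
  ultimately have "klein_group \<subseteq> ?H"
    unfolding klein_group_def by (intro B.generate_subgroup_incl)
  then show ?thesis using assms unfolding k_def by blast
qed

text \<open>The parity of the number of half translations separates the lattice translations, which
  are the deck transformations of the torus, from the orientation-reversing elements.\<close>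

lemma klein_group_cases:
  assumes "g \<in> klein_group"
  shows "g \<in> torus_group \<or> (\<exists>m n. g = (\<lambda>(x, y). (- x + of_int m, y + of_int n + 1 / 2)))"
proof -
  obtain m n where g: "g = (\<lambda>(x, y). ((if even n then x else - x) + of_int m, y + of_int n / 2))"
    using klein_group_elem[OF assms] by blast
  show ?thesis
  proof (cases "even n")
    case True
    then obtain k where "n = 2 * k" by blast
    then have "g = (\<lambda>(x, y). (x + of_int m, y + of_int k))" using g by auto
    then show ?thesis unfolding torus_group_def by blast
  next
    case False
    then obtain k where "n = 2 * k + 1" by (rule oddE)
    then have "g = (\<lambda>(x, y). (- x + of_int m, y + of_int k + 1 / 2))"
      using g by (auto simp: add_divide_distrib)
    then show ?thesis by blast
  qed
qed

text \<open>The square of the glide reflection is the unit translation in \<open>y\<close>; together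
  with the first generator it spans all lattice translations.\<close>

lemma torus_group_subset_klein_group: "torus_group \<subseteq> klein_group"
proof -
  let ?t = "\<lambda>m n (x, y). (x + of_int m, y + of_int n) :: real \<times> real"
  have comp: "g \<circ> h \<in> klein_group" if "g \<in> klein_group" "h \<in> klein_group" for g h
    using isometry_group_klein that unfolding isometry_group_def by blast
  have inverse: "\<exists>h\<in>klein_group. h \<circ> g = id" if "g \<in> klein_group" for g
    using isometry_group_klein that unfolding isometry_group_def by (elim conjE) blast
  have t: "?t m n \<circ> ?t m' n' = ?t (m + m') (n + n')" for m n m' n' by (auto simp: fun_eq_iff)
  have t0: "?t 0 0 = id" by (auto simp: fun_eq_iff)
  have inv: "?t (- m) (- n) \<in> klein_group" if mn: "?t m n \<in> klein_group" for m n
  proof -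
    obtain h where h: "h \<in> klein_group" "h \<circ> ?t m n = id"
      using inverse[OF mn] by blast
    \<comment> \<open>Inverses of maps are unique, so the inverse found in the group is the opposite
      translation.\<close>
    have "?t m n \<circ> ?t (- m) (- n) = id" by (auto simp: fun_eq_iff)
    then have "h = ?t (- m) (- n)" using h(2) by (rule left_right_inverse_eq[rotated])
    then show ?thesis using h(1) by simp
  qed
  have multiples: "?t (k * m) (k * n) \<in> klein_group" if mn: "?t m n \<in> klein_group" for k m n
  proof (induction k rule: int_induct[of _ 0])
    case base
    have "id \<in> klein_group" using isometry_group_klein unfolding isometry_group_def by (rule conjunct1)
    then show ?case by (simp only: mult_zero_left t0)
  next
    case (step1 i)
    then show ?case using comp[OF step1(2) mn] unfolding t by (simp add: distrib_right)
  next
    case (step2 i)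
    then show ?case using comp[OF step2(2) inv[OF mn]] unfolding t by (simp add: left_diff_distrib)
  qed
  let ?b = "\<lambda>(x, y). (1 - x, y + 1 / 2) :: real \<times> real"
  have gens: "(\<lambda>(x, y). (x + 1, y)) \<in> klein_group" "?b \<in> klein_group"
    unfolding klein_group_def by (auto intro: generate.incl)
  have "?t 1 0 = (\<lambda>(x, y). (x + 1, y))" by auto
  then have "?t 1 0 \<in> klein_group" using gens(1) by simp
  moreover have "?t 0 1 = ?b \<circ> ?b" by (auto simp: fun_eq_iff)
  then have "?t 0 1 \<in> klein_group" using comp[OF gens(2) gens(2)] by simp
  ultimately have "?t (m * 1) (m * 0) \<circ> ?t (n * 0) (n * 1) \<in> klein_group" for m n
    by (intro comp multiples)
  then have "?t m n \<in> klein_group" for m n unfolding t by simp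
  then show ?thesis unfolding torus_group_def by blast
qed

section \<open>The embedding and its expression in charts\<close>

definition semidisk_map :: "(real \<times> real) \<times> (real \<times> real) set \<Rightarrow> ((real \<times> real) set, real \<times> real) covector"
  where "semidisk_map = (\<lambda>(a, p). quotient_covector klein_group (SOME u. u \<in> p) a)"

text \<open>The chosen representative of a torus point differs from \<open>u\<close> by a lattice
  translation. This lies in the Klein group and has linear part \<open>id\<close>, so by
  equivariance the choice changes neither the base point nor the covector.\<close>

lemma semidisk_map_orbit: "semidisk_map (a, orbit_of torus_group u) = quotient_covector klein_group u a"
proof -
  have "u \<in> orbit_of torus_group u"
    using isometry_group_torus unfolding isometry_group_def orbit_of_def
    by (metis (mono_tags, lifting) id_apply mem_Collect_eq)
  then have "(SOME v. v \<in> orbit_of torus_group u) \<in> orbit_of torus_group u" by (rule someI)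
  then obtain g where g: "g \<in> torus_group" "(SOME v. v \<in> orbit_of torus_group u) = g u"
    unfolding orbit_of_def by auto
  then obtain m n where mn: "g = (\<lambda>(x, y). (x + of_int m, y + of_int n))"
    unfolding torus_group_def by auto
  have gid: "g = (\<lambda>u. id u + (of_int m, of_int n))" unfolding mn by auto
  have "g \<in> klein_group" using g torus_group_subset_klein_group by blast
  from quotient_covector_equivariant[OF isometry_group_klein this[unfolded gid], of u a]
  show ?thesis unfolding semidisk_map_def using g(2) gid
    by (simp add: orthogonal_transformation_def linear_id)
qed

lemma norm_semidisk: "a \<in> semidisk \<Longrightarrow> norm a < 1"
  unfolding semidisk_def by (auto simp: norm_prod_def)

text \<open>The deck transformation of the double cover acts on covectors by reversing \<open>I\<^sub>1\<close>, so it does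
  not identify points of the half \<open>I\<^sub>1 > 0\<close>.\<close>

lemma quotient_covector_semidisk_inj:
  assumes "a \<in> semidisk" "b \<in> semidisk"
    and "quotient_covector klein_group u a = quotient_covector klein_group v b"
  shows "a = b \<and> orbit_of torus_group u = orbit_of torus_group v"
proof -
  obtain L t where L: "(\<lambda>u. L u + t) \<in> klein_group" "orthogonal_transformation L" "v = L u + t" "b = L a"
    using quotient_covector_eqD[OF isometry_group_klein assms(3)] by metis
  let ?g = "\<lambda>u. L u + t"
  have L0: "L 0 = 0" using L(2) linear_0 orthogonal_transformation_linear by blast
  \<comment> \<open>The linear part is read off from two values of the affine map, since the group
    description gives \<open>?g\<close> as a whole and not \<open>L\<close> and \<open>t\<close>
    separately.\<close>
  then have t: "t = ?g 0" and La: "b = ?g a - t" using L(4) by auto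
  from klein_group_cases[OF L(1)] show ?thesis
  proof
    assume g: "?g \<in> torus_group"
    then obtain m n where "?g = (\<lambda>(x, y). (x + of_int m, y + of_int n))"
      unfolding torus_group_def by auto
    then have "?g z = z + (of_int m, of_int n)" for z by (metis add_Pair case_prod_beta prod.collapse)
    then have "a = b" using t La by (metis add_0 add_diff_cancel_right')
    moreover have "orbit_of torus_group u = orbit_of torus_group v"
      unfolding orbit_of_eq_iff[OF isometry_group_torus] using L(3) by (intro bexI[OF _ g])
    ultimately show ?thesis by simp
  next
    assume "\<exists>m n. ?g = (\<lambda>(x, y). (- x + of_int m, y + of_int n + 1 / 2))"
    then obtain m n where "?g = (\<lambda>(x, y). (- x + of_int m, y + of_int n + 1 / 2))" by blast
    then have *: "?g z = (- fst z + of_int m, snd z + of_int n + 1 / 2)" for z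
      by (metis case_prod_beta)
    have "?g a - ?g 0 = (- fst a, snd a)" unfolding * by simp
    then have "fst b = - fst a" using La t by (metis fst_conv)
    moreover have "fst a > 0" "fst b > 0" using assms unfolding semidisk_def by auto
    ultimately show ?thesis by simp
  qed
qed

text \<open>A chart of the Klein bottle composed with the projection is locally an affine isometry
  with linear part \<open>M\<close>. It moves base points affinely, and covectors by
  \<open>M\<close> alone. The factors are exchanged because toric charts list the action variables
  first and cotangent charts list the base point first.\<close>

lemma semidisk_map_affine_iso:
  assumes c': "c' \<in> toric_semidisk" and d': "d' \<in> DK" and x: "x \<in> fst c'" "semidisk_map x \<in> fst d'"
  obtains M where "orthogonal_transformation M"
    "affine_iso_at c' d' semidisk_map x (\<lambda>(j, u). (M u, M j))"
proof -
  obtain c where c: "c \<in> torus" "fst c' = semidisk \<times> fst c" "snd c' = map_prod id (snd c)"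
    "inj_on (snd c') (fst c')"
    using toric_chart_cases[OF c'] by metis
  obtain W where W: "open W" "fst c = orbit_of torus_group ` W"
    "\<And>u. u \<in> W \<Longrightarrow> snd c (orbit_of torus_group u) = u"
    using quotient_chart_cases c(1) unfolding torus_def by metis
  obtain d where d: "d \<in> quotient_atlas klein_group" "snd d' = (\<lambda>(p, \<xi>). (snd d p, \<xi> d))"
    "\<And>p \<xi>. (p, \<xi>) \<in> fst d' \<longleftrightarrow>
      (p, \<xi>) \<in> cotangent_bundle (quotient_atlas klein_group) \<and> p \<in> fst d \<and> norm (\<xi> d) < 1"
    using disk_chart_cases[OF isometry_group_klein d'[unfolded DK_def klein_bottle_def]] by metis
  obtain i u where iu: "x = (i, orbit_of torus_group u)" "i \<in> semidisk" "u \<in> W"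
    using x(1) c(2) W(2) by auto
  have "orbit_of klein_group u \<in> fst d"
    using x(2) d(3) unfolding iu(1) semidisk_map_orbit quotient_covector_def by blast
  from chart_orbit_locally_affine[OF isometry_group_klein d(1) this]
  obtain N M b where N: "open N" "u \<in> N" "orthogonal_transformation M"
    "\<And>y. y \<in> N \<Longrightarrow> orbit_of klein_group y \<in> fst d"
    "\<And>y. y \<in> N \<Longrightarrow> snd d (orbit_of klein_group y) = M y + b"
    "\<And>y. y \<in> N \<Longrightarrow> ((snd d \<circ> orbit_of klein_group) has_derivative M) (at y)"
    by metis
  have main: "(j, y) \<in> snd c' ` {q \<in> fst c'. semidisk_map q \<in> fst d'} \<and>
      transition c' d' semidisk_map (j, y) = (M y, M j) + (b, 0)"
    if jy: "j \<in> semidisk" "y \<in> W" "y \<in> N" for j y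
  proof -
    let ?q = "(j, orbit_of torus_group y)"
    have q: "?q \<in> fst c'" "snd c' ?q = (j, y)" using c(2,3) W jy by auto
    \<comment> \<open>The derivative is the same \<open>M\<close> at every point of
      \<open>N\<close>, so the fibre component does not depend on \<open>y\<close> and the chart
      expression is affine jointly in both variables.\<close>
    have "frechet_derivative (snd d \<circ> orbit_of klein_group) (at y) = M"
      using frechet_derivative_at[OF N(6)[OF jy(3)]] by simp
    then have comp: "snd (quotient_covector klein_group y j) d = M j"
      using d(1) N(4)[OF jy(3)] by (simp add: quotient_covector_def)
    have fst: "fst (quotient_covector klein_group y j) = orbit_of klein_group y"
      by (simp add: quotient_covector_def)
    have "norm (M j) < 1" using norm_semidisk[OF jy(1)] N(3) orthogonal_transformation_norm by metis
    then have "semidisk_map ?q \<in> fst d'"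
      using d(3) quotient_covector_in_bundle[OF isometry_group_klein, of y j] N(4)[OF jy(3)] comp fst
      unfolding semidisk_map_orbit by (metis prod.collapse)
    moreover have "inv_into (fst c') (snd c') (j, y) = ?q" using inv_into_f_f[OF c(4) q(1)] q(2) by simp
    then have "transition c' d' semidisk_map (j, y) = snd d' (quotient_covector klein_group y j)"
      by (simp add: transition_def semidisk_map_orbit)
    then have "transition c' d' semidisk_map (j, y) = (M y, M j) + (b, 0)"
      using N(5)[OF jy(3)] comp fst d(2) by (simp add: case_prod_beta)
    ultimately show ?thesis using q by (auto intro!: rev_image_eqI)
  qed
  have lin: "linear M" using N(3) orthogonal_transformation_linear by blast
  have bijM: "bij M" using N(3) orthogonal_transformation_bij by blast
  have "linear (\<lambda>(j, u). (M u, M j))"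
    using lin by (intro linearI) (simp_all add: linear_add linear_cmul case_prod_beta)
  moreover have "bij (\<lambda>(j, u). (M u, M j))"
    by (rule bij_betw_byWitness[of _ "\<lambda>(v, k). (inv_into UNIV M k, inv_into UNIV M v)"])
       (use bijM in \<open>auto simp: bij_is_inj bij_is_surj surj_f_inv_f\<close>)
  \<comment> \<open>On \<open>W\<close> the torus chart inverts the projection from the plane, and
    on \<open>N\<close> the chart of the Klein bottle is affine; both are required at once.\<close>
  moreover have "open (semidisk \<times> (W \<inter> N))" using open_semidisk W(1) N(1) by (intro open_Times open_Int)
  moreover have "snd c' x \<in> semidisk \<times> (W \<inter> N)" using c(3) iu W(3) N(2) by simp
  ultimately have "affine_iso_at c' d' semidisk_map x (\<lambda>(j, u). (M u, M j))"
    unfolding affine_iso_at_def using main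
    by (intro conjI exI[of _ "semidisk \<times> (W \<inter> N)"] exI[of _ "(b, 0)"]) auto
  then show ?thesis using that N(3) by blast
qed

lemma toric_semidisk_carrier:
  assumes "x \<in> atlas_carrier toric_semidisk"
  obtains a u where "a \<in> semidisk" "x = (a, orbit_of torus_group u)"
proof -
  obtain c' where c': "c' \<in> toric_semidisk" "x \<in> fst c'"
    using assms unfolding atlas_carrier_def by auto
  obtain c where c: "c \<in> torus" "fst c' = semidisk \<times> fst c" using toric_chart_cases[OF c'(1)] by metis
  obtain W where "fst c = orbit_of torus_group ` W"
    using quotient_chart_cases c(1) unfolding torus_def by metis
  then show ?thesis using that c' c by auto
qed

theorem proposition1p8:
  shows "\<exists>f. symplectic_embedding toric_semidisk omega_0 DK omega_st f"
proof
  have "smooth_embedding toric_semidisk DK semidisk_map"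
  proof (rule smooth_embedding_if_affine_iso[OF smooth_atlas_toric_semidisk smooth_atlas_DK])
    show "semidisk_map \<in> atlas_carrier toric_semidisk \<rightarrow> atlas_carrier DK"
    proof
      fix x assume "x \<in> atlas_carrier toric_semidisk"
      then obtain a u where "a \<in> semidisk" "x = (a, orbit_of torus_group u)"
        by (rule toric_semidisk_carrier)
      then show "semidisk_map x \<in> atlas_carrier DK"
        using quotient_covector_in_disk_bundle[OF isometry_group_klein norm_semidisk]
        by (simp add: semidisk_map_orbit DK_def klein_bottle_def)
    qed
    show "inj_on semidisk_map (atlas_carrier toric_semidisk)"
    proof (rule inj_onI)
      fix x y
      assume "x \<in> atlas_carrier toric_semidisk" "y \<in> atlas_carrier toric_semidisk"
        and eq: "semidisk_map x = semidisk_map y"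
      then obtain a u b v where "a \<in> semidisk" "x = (a, orbit_of torus_group u)"
        "b \<in> semidisk" "y = (b, orbit_of torus_group v)"
        by (metis toric_semidisk_carrier)
      then show "x = y"
        using quotient_covector_semidisk_inj[of a b u v] eq by (simp add: semidisk_map_orbit)
    qed
    show "\<exists>L. affine_iso_at c d semidisk_map p L"
      if "c \<in> toric_semidisk" "d \<in> DK" "p \<in> fst c" "semidisk_map p \<in> fst d" for c d p
      using semidisk_map_affine_iso[OF that] by blast
  qed
  moreover have "pulls_back_to toric_semidisk omega_0 DK omega_st semidisk_map"
    unfolding pulls_back_to_def
  proof (intro ballI impI allI)
    fix c d p v w
    assume "c \<in> toric_semidisk" "d \<in> DK" "p \<in> fst c" "semidisk_map p \<in> fst d"
    then obtain M where M: "orthogonal_transformation M"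
      "affine_iso_at c d semidisk_map p (\<lambda>(j, u). (M u, M j))"
      by (rule semidisk_map_affine_iso)
    \<comment> \<open>Written with inner products, the two forms differ only by the exchange of the
      base and fibre factors. The differential performs this exchange and applies \<open>M\<close>
      to both factors, which preserves the inner products.\<close>
    have st: "omega_st d (snd d (semidisk_map p)) v w = fst v \<bullet> snd w - fst w \<bullet> snd v" for v w
      by (simp add: omega_st_def wedge_def inner_prod_def case_prod_beta)
    have 0: "omega_0 c (snd c p) v w = snd v \<bullet> fst w - snd w \<bullet> fst v" for v w
      by (simp add: omega_0_def wedge_def inner_prod_def case_prod_beta)
    show "omega_st d (snd d (semidisk_map p)) (differential c d semidisk_map p v)
        (differential c d semidisk_map p w) = omega_0 c (snd c p) v w"
      unfolding differential_affine_iso[OF M(2)] st 0 using M(1)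
      by (simp add: orthogonal_transformation_def case_prod_beta del: split_paired_All)
  qed
  ultimately show "symplectic_embedding toric_semidisk omega_0 DK omega_st semidisk_map"
    unfolding symplectic_embedding_def by blast
qed

end
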